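(* For any $\ell\in\mathbb Z\setminus\{0\}$, there is an isomorphism of $\mathbb C(q^{1/2})$-algebras $\psi: G_q/\langle\gamma-q^\ell\rangle\to A_{n\cdot\infty}$ given by $h_{ik}\mapsto[k\ell]_q\cdot\partial_{ik}$ and $h'_{i,-k}\mapsto X_{ik}$ for all $i\in I$, $k\in\mathbb Z_{>0}$.
   Context: Let $I=\{1,\dots,n\}$, let $(a_{ij})_{0\le i,j\le n}$ be the generalized Cartan matrix of an untwisted affine Kac-Moody algebra, and let $d_0,\dots,d_n$ be relatively prime positive integers such that $(d_ia_{ij})$ is symmetric. Put $q_i=q^{d_i}$, $[m]_{q_i}=\frac{q_i^m-q_i^{-m}}{q_i-q_i^{-1}}$, $[m]_q=\frac{q^m-q^{-m}}{q-q^{-1}}$. The quantum Heisenberg algebra $G_q$ (a subalgebra of the quantum affine algebra in its Drinfeld presentation) is generated over $\mathbb C(q^{1/2})$ by $h_{ik}$ ($i\in I$, $k\in\mathbb Z_{\neq0}$) and $\gamma^{\pm1/2}$ (mutually inverse, with $\gamma=(\gamma^{1/2})^2$), where $\gamma^{\pm1/2}$ is central and $$h_{ik}h_{jl}-h_{jl}h_{ik}=\delta_{k+l,0}\,a_{ij;q}^k\,\frac{\gamma^k-\gamma^{-k}}{q-q^{-1}},\qquad a^k_{ij;q}=\frac{[k a_{ij}]_{q_i}}{k\,[d_j]_q},\qquad i,j\in I,\ k,l\in\mathbb Z_{\ne0}.$$ For each $k\neq0$ the matrix $(a^k_{ij;q})_{i,j\in I}$ is invertible; let $(b^k_{ij;q})_{i,j\in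 I}$ be its inverse and set $h'_{j,-k}=\sum_{m=1}^nb^k_{mj;q}h_{m,-k}$ for $j\in I$, $k\in\mathbb Z_{>0}$. $A_{n\cdot\infty}$ is the countably infinite rank Weyl algebra (over $\mathbb C(q^{1/2})$) with generators $X_{ik},\partial_{ik}$ ($i\in I$, $k\in\mathbb Z_{>0}$) and relations $\partial_{ik}X_{ik}-X_{ik}\partial_{ik}=1$, and $X_{ik}X_{jl}-X_{jl}X_{ik}=\partial_{ik}X_{jl}-X_{jl}\partial_{ik}=\partial_{ik}\partial_{jl}-\partial_{jl}\partial_{ik}=0$ for $(i,k)\ne(j,l)$. $\langle\cdot\rangle$ denotes the two-sided ideal generated.
   Formalization: The ideal is generated by γ − q^ℓ together with γ^{1/2} − q^{ℓ/2}; with γ − q^ℓ alone the sign of γ^{1/2} stays free and the quotient is a product of two copies of the Weyl algebra, so the literal claim fails. *)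

theory Defs
  imports
    "HOL-Algebra.QuotRing"
    "HOL-Algebra.Module"
    "HOL-Computational_Algebra.Polynomial"
    "HOL-Computational_Algebra.Fraction_Field"
begin

section \<open>Untwisted affine generalized Cartan matrices\<close>

definition gen_cartan_matrix :: "nat set \<Rightarrow> (nat \<Rightarrow> nat \<Rightarrow> int) \<Rightarrow> bool" where
  "gen_cartan_matrix S a \<longleftrightarrow>
     (\<forall>i\<in>S. a i i = 2) \<and>
     (\<forall>i\<in>S. \<forall>j\<in>S. i \<noteq> j \<longrightarrow> a i j \<le> 0) \<and>
     (\<forall>i\<in>S. \<forall>j\<in>S. a i j = 0 \<longleftrightarrow> a j i = 0)"

definition indecomposable_matrix :: "nat set \<Rightarrow> (nat \<Rightarrow> nat \<Rightarrow> int) \<Rightarrow> bool" where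
  "indecomposable_matrix S a \<longleftrightarrow>
     S \<noteq> {} \<and> (\<forall>J. J \<subseteq> S \<and> J \<noteq> {} \<and> J \<noteq> S \<longrightarrow> (\<exists>i\<in>J. \<exists>j\<in>S - J. a i j \<noteq> 0))"

text \<open>
  The invariant form on the root lattice \<open>\<Oplus>\<^sub>i \<int>\<alpha>\<^sub>i\<close>, normalised by
  \<open>(\<alpha>\<^sub>i|\<alpha>\<^sub>j) = D\<^sub>i a\<^sub>i\<^sub>j\<close>; vectors are given by their coordinates with respect to the simple roots.
\<close>

definition cartan_form ::
  "nat set \<Rightarrow> (nat \<Rightarrow> nat \<Rightarrow> int) \<Rightarrow> (nat \<Rightarrow> real) \<Rightarrow> (nat \<Rightarrow> real) \<Rightarrow> (nat \<Rightarrow> real) \<Rightarrow> real" where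
  "cartan_form S a D x y = (\<Sum>i\<in>S. \<Sum>j\<in>S. D i * of_int (a i j) * x i * y j)"

definition finite_type_symmetrizer ::
  "nat set \<Rightarrow> (nat \<Rightarrow> nat \<Rightarrow> int) \<Rightarrow> (nat \<Rightarrow> real) \<Rightarrow> bool" where
  "finite_type_symmetrizer S a D \<longleftrightarrow>
     (\<forall>i\<in>S. D i > 0) \<and>
     (\<forall>i\<in>S. \<forall>j\<in>S. D i * of_int (a i j) = D j * of_int (a j i)) \<and>
     (\<forall>x. (\<exists>i\<in>S. x i \<noteq> 0) \<longrightarrow> cartan_form S a D x x > 0)"

definition simple_root :: "nat \<Rightarrow> nat \<Rightarrow> int" where
  "simple_root i = (\<lambda>j. if j = i then 1 else 0)"

text \<open>
  With \<open>a\<^sub>i\<^sub>j = \<langle>\<alpha>\<^sub>i\<^sup>\<or>, \<alpha>\<^sub>j\<rangle>\<close> the simple reflection is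
  \<open>s\<^sub>i(x) = x - \<langle>\<alpha>\<^sub>i\<^sup>\<or>, x\<rangle> \<alpha>\<^sub>i\<close>. In finite type the roots are the Weyl group orbits of the simple roots.
\<close>

inductive_set roots :: "nat set \<Rightarrow> (nat \<Rightarrow> nat \<Rightarrow> int) \<Rightarrow> (nat \<Rightarrow> int) set"
  for S a where
  simple: "i \<in> S \<Longrightarrow> simple_root i \<in> roots S a"
| reflect: "x \<in> roots S a \<Longrightarrow> i \<in> S \<Longrightarrow> x(i := x i - (\<Sum>j\<in>S. a i j * x j)) \<in> roots S a"

definition highest_root :: "nat set \<Rightarrow> (nat \<Rightarrow> nat \<Rightarrow> int) \<Rightarrow> (nat \<Rightarrow> int) \<Rightarrow> bool" where
  "highest_root S a \<theta> \<longleftrightarrow> \<theta> \<in> roots S a \<and> (\<forall>\<beta>\<in>roots S a. \<forall>i\<in>S. \<beta> i \<le> \<theta> i)"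

text \<open>
  The matrix \<open>(a\<^sub>i\<^sub>j)\<close>, \<open>0 \<le> i, j \<le> n\<close>, of the affinization of a simple Lie algebra: the rows and
  columns \<open>1, \<dots>, n\<close> form an indecomposable Cartan matrix of finite type, and node \<open>0\<close> is
  the affine node, with simple root \<open>\<alpha>\<^sub>0 = \<delta> - \<theta>\<close>. Hence \<open>a\<^sub>i\<^sub>0 = -\<langle>\<alpha>\<^sub>i\<^sup>\<or>, \<theta>\<rangle>\<close> and
  \<open>a\<^sub>0\<^sub>i = -\<langle>\<theta>\<^sup>\<or>, \<alpha>\<^sub>i\<rangle> = -2(\<theta>|\<alpha>\<^sub>i)/(\<theta>|\<theta>)\<close>; the latter does not depend on the choice of
  \<open>D\<close>, which is unique up to a scalar.
\<close>

definition untwisted_affine_cartan_matrix :: "nat \<Rightarrow> (nat \<Rightarrow> nat \<Rightarrow> int) \<Rightarrow> bool" where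
  "untwisted_affine_cartan_matrix n a \<longleftrightarrow>
     gen_cartan_matrix {1..n} a \<and> indecomposable_matrix {1..n} a \<and>
     (\<exists>D \<theta>. finite_type_symmetrizer {1..n} a D \<and> highest_root {1..n} a \<theta> \<and>
        a 0 0 = 2 \<and>
        (\<forall>i\<in>{1..n}. a i 0 = - (\<Sum>j\<in>{1..n}. a i j * \<theta> j)) \<and>
        (\<forall>i\<in>{1..n}. of_int (a 0 i) =
            - 2 * cartan_form {1..n} a D (of_int \<circ> \<theta>) (of_int \<circ> simple_root i)
                / cartan_form {1..n} a D (of_int \<circ> \<theta>) (of_int \<circ> \<theta>)))"


section \<open>Associative algebras given by generators and relations\<close>

text \<open>
  A unital associative algebra is represented by a \<^typ>\<open>('k, 'a) module\<close> record, that is, a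
  ring record together with a scalar multiplication.

  The free algebra on a set \<open>S\<close> of generators: finitely supported functions on the words over
  \<open>S\<close>, multiplied by convolution with respect to concatenation.
\<close>

definition free_algebra :: "'x set \<Rightarrow> ('k::field, 'x list \<Rightarrow> 'k) module" where
  "free_algebra S =
     \<lparr>carrier = {f. finite {w. f w \<noteq> 0} \<and> {w. f w \<noteq> 0} \<subseteq> lists S},
      monoid.mult = (\<lambda>f g w. \<Sum>i\<le>length w. f (take i w) * g (drop i w)),
      one = (\<lambda>w. if w = [] then 1 else 0),
      zero = (\<lambda>w. 0),
      add = (\<lambda>f g w. f w + g w),
      module.smult = (\<lambda>c f w. c * f w)\<rparr>"

definition free_gen :: "'x \<Rightarrow> 'x list \<Rightarrow> 'k::field" where
  "free_gen x = (\<lambda>w. if w = [x] then 1 else 0)"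

definition quot_algebra :: "('k, 'a, 'm) module_scheme \<Rightarrow> 'a set \<Rightarrow> ('k, 'a set) module" where
  "quot_algebra A J =
     ring.extend (A Quot J) \<lparr>module.smult = (\<lambda>c X. \<Union>x\<in>X. J +>\<^bsub>A\<^esub> (c \<odot>\<^bsub>A\<^esub> x))\<rparr>"

definition presented_algebra ::
  "'x set \<Rightarrow> ('x list \<Rightarrow> 'k::field) set \<Rightarrow> ('k, ('x list \<Rightarrow> 'k) set) module" where
  "presented_algebra S R = quot_algebra (free_algebra S) (Idl\<^bsub>free_algebra S\<^esub> R)"

definition presented_gen ::
  "'x set \<Rightarrow> ('x list \<Rightarrow> 'k::field) set \<Rightarrow> 'x \<Rightarrow> ('x list \<Rightarrow> 'k) set" where
  "presented_gen S R x = (Idl\<^bsub>free_algebra S\<^esub> R) +>\<^bsub>free_algebra S\<^esub> free_gen x"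

definition commutator :: "('a, 'm) ring_scheme \<Rightarrow> 'a \<Rightarrow> 'a \<Rightarrow> 'a" where
  "commutator A x y = x \<otimes>\<^bsub>A\<^esub> y \<ominus>\<^bsub>A\<^esub> y \<otimes>\<^bsub>A\<^esub> x"

definition algebra_iso ::
  "('k, 'a, 'm) module_scheme \<Rightarrow> ('k, 'b, 'l) module_scheme \<Rightarrow> ('a \<Rightarrow> 'b) set" where
  "algebra_iso A B =
     {\<phi> \<in> ring_iso A B. \<forall>c. \<forall>x\<in>carrier A. \<phi> (c \<odot>\<^bsub>A\<^esub> x) = c \<odot>\<^bsub>B\<^esub> \<phi> x}"


section \<open>The ground field and quantum numbers\<close>

text \<open>The field \<open>\<complex>(q\<^sup>1\<^sup>/\<^sup>2)\<close> of rational functions; \<open>q_half\<close> is its indeterminate.\<close>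

type_synonym qfield = "complex poly fract"

definition q_half :: qfield where "q_half = Fract [:0, 1:] 1"

definition q :: qfield where "q = q_half ^ 2"

definition qnum :: "qfield \<Rightarrow> int \<Rightarrow> qfield" where
  "qnum v m = (v powi m - v powi (- m)) / (v - inverse v)"

definition qa :: "(nat \<Rightarrow> nat \<Rightarrow> int) \<Rightarrow> (nat \<Rightarrow> nat) \<Rightarrow> int \<Rightarrow> nat \<Rightarrow> nat \<Rightarrow> qfield" where
  "qa a d k i j = qnum (q ^ d i) (k * a i j) / (of_int k * qnum q (int (d j)))"

definition is_inverse_matrix ::
  "nat set \<Rightarrow> (nat \<Rightarrow> nat \<Rightarrow> 'k::field) \<Rightarrow> (nat \<Rightarrow> nat \<Rightarrow> 'k) \<Rightarrow> bool" where
  "is_inverse_matrix S A B \<longleftrightarrow>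
     (\<forall>i\<in>S. \<forall>j\<in>S. (\<Sum>m\<in>S. A i m * B m j) = (if i = j then 1 else 0)) \<and>
     (\<forall>i\<in>S. \<forall>j\<in>S. (\<Sum>m\<in>S. B i m * A m j) = (if i = j then 1 else 0))"

text \<open>The inverse matrix: its entries with indices in \<open>{1..n}\<close> are uniquely determined; no others are ever used.\<close>

definition qb ::
  "nat \<Rightarrow> (nat \<Rightarrow> nat \<Rightarrow> int) \<Rightarrow> (nat \<Rightarrow> nat) \<Rightarrow> int \<Rightarrow> nat \<Rightarrow> nat \<Rightarrow> qfield" where
  "qb n a d k = (SOME B. is_inverse_matrix {1..n} (qa a d k) B)"


section \<open>The quantum Heisenberg algebra\<close>

datatype heis_symbol = H nat int | Gamma_Half | Gamma_Neg_Half

definition heis_symbols :: "nat \<Rightarrow> heis_symbol set" where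
  "heis_symbols n = {H i k | i k. i \<in> {1..n} \<and> k \<noteq> 0} \<union> {Gamma_Half, Gamma_Neg_Half}"

abbreviation heis_free :: "nat \<Rightarrow> (qfield, heis_symbol list \<Rightarrow> qfield) module" where
  "heis_free n \<equiv> free_algebra (heis_symbols n)"

text \<open>
  The word representing \<open>\<gamma>\<^sup>k\<close>. Negative powers are powers of the generator
  \<open>\<gamma>\<^sup>-\<^sup>1\<^sup>/\<^sup>2\<close>, which is inverse to \<open>\<gamma>\<^sup>1\<^sup>/\<^sup>2\<close> only modulo the relations.
\<close>

definition heis_gamma_free :: "nat \<Rightarrow> int \<Rightarrow> heis_symbol list \<Rightarrow> qfield" where
  "heis_gamma_free n k =
     (if k \<ge> 0 then free_gen Gamma_Half [^]\<^bsub>heis_free n\<^esub> (2 * nat k)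
      else free_gen Gamma_Neg_Half [^]\<^bsub>heis_free n\<^esub> (2 * nat (- k)))"

definition heis_relations ::
  "nat \<Rightarrow> (nat \<Rightarrow> nat \<Rightarrow> int) \<Rightarrow> (nat \<Rightarrow> nat) \<Rightarrow> (heis_symbol list \<Rightarrow> qfield) set" where
  "heis_relations n a d =
     {free_gen Gamma_Half \<otimes>\<^bsub>heis_free n\<^esub> free_gen Gamma_Neg_Half
        \<ominus>\<^bsub>heis_free n\<^esub> \<one>\<^bsub>heis_free n\<^esub>,
      free_gen Gamma_Neg_Half \<otimes>\<^bsub>heis_free n\<^esub> free_gen Gamma_Half
        \<ominus>\<^bsub>heis_free n\<^esub> \<one>\<^bsub>heis_free n\<^esub>} \<union>
     {commutator (heis_free n) (free_gen g) (free_gen x) | g x.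
        g \<in> {Gamma_Half, Gamma_Neg_Half} \<and> x \<in> heis_symbols n} \<union>
     {commutator (heis_free n) (free_gen (H i k)) (free_gen (H j l))
        \<ominus>\<^bsub>heis_free n\<^esub>
          ((if k + l = 0 then qa a d k i j / (q - inverse q) else 0) \<odot>\<^bsub>heis_free n\<^esub>
             (heis_gamma_free n k \<ominus>\<^bsub>heis_free n\<^esub> heis_gamma_free n (- k))) | i j k l.
        i \<in> {1..n} \<and> j \<in> {1..n} \<and> k \<noteq> 0 \<and> l \<noteq> 0}"

definition heis ::
  "nat \<Rightarrow> (nat \<Rightarrow> nat \<Rightarrow> int) \<Rightarrow> (nat \<Rightarrow> nat) \<Rightarrow> (qfield, (heis_symbol list \<Rightarrow> qfield) set) module" where
  "heis n a d = presented_algebra (heis_symbols n) (heis_relations n a d)"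

definition heis_gen ::
  "nat \<Rightarrow> (nat \<Rightarrow> nat \<Rightarrow> int) \<Rightarrow> (nat \<Rightarrow> nat) \<Rightarrow> heis_symbol \<Rightarrow> (heis_symbol list \<Rightarrow> qfield) set" where
  "heis_gen n a d x = presented_gen (heis_symbols n) (heis_relations n a d) x"

abbreviation heis_h ::
  "nat \<Rightarrow> (nat \<Rightarrow> nat \<Rightarrow> int) \<Rightarrow> (nat \<Rightarrow> nat) \<Rightarrow> nat \<Rightarrow> int \<Rightarrow> (heis_symbol list \<Rightarrow> qfield) set" where
  "heis_h n a d i k \<equiv> heis_gen n a d (H i k)"

text \<open>For \<open>k > 0\<close>, \<open>heis_h' n a d j k\<close> is the element written \<open>h'\<close> with subscripts \<open>j, -k\<close>.\<close>

definition heis_h' ::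
  "nat \<Rightarrow> (nat \<Rightarrow> nat \<Rightarrow> int) \<Rightarrow> (nat \<Rightarrow> nat) \<Rightarrow> nat \<Rightarrow> int \<Rightarrow> (heis_symbol list \<Rightarrow> qfield) set" where
  "heis_h' n a d j k =
     (\<Oplus>\<^bsub>heis n a d\<^esub>m\<in>{1..n}. qb n a d k m j \<odot>\<^bsub>heis n a d\<^esub> heis_h n a d m (- k))"

text \<open>
  The ideal of the specialization \<open>\<gamma> = q\<^sup>l\<close>. Since \<open>\<gamma>\<^sup>1\<^sup>/\<^sup>2\<close> is itself a generator, specializing
  \<open>\<gamma>\<close> includes specializing its square root to \<open>q\<^sup>l\<^sup>/\<^sup>2\<close>. The element
  \<open>\<gamma> - q\<^sup>l = (\<gamma>\<^sup>1\<^sup>/\<^sup>2 - q\<^sup>l\<^sup>/\<^sup>2) (\<gamma>\<^sup>1\<^sup>/\<^sup>2 + q\<^sup>l\<^sup>/\<^sup>2)\<close> alone would leave the sign of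
  \<open>\<gamma>\<^sup>1\<^sup>/\<^sup>2\<close> free, and its quotient would be a product of two copies of the Weyl algebra.
\<close>

definition heis_level_ideal ::
  "nat \<Rightarrow> (nat \<Rightarrow> nat \<Rightarrow> int) \<Rightarrow> (nat \<Rightarrow> nat) \<Rightarrow> int \<Rightarrow> (heis_symbol list \<Rightarrow> qfield) set set" where
  "heis_level_ideal n a d l =
     Idl\<^bsub>heis n a d\<^esub>
       {heis_gen n a d Gamma_Half [^]\<^bsub>heis n a d\<^esub> (2::nat)
          \<ominus>\<^bsub>heis n a d\<^esub> (q powi l) \<odot>\<^bsub>heis n a d\<^esub> \<one>\<^bsub>heis n a d\<^esub>,
        heis_gen n a d Gamma_Half
          \<ominus>\<^bsub>heis n a d\<^esub> (q_half powi l) \<odot>\<^bsub>heis n a d\<^esub> \<one>\<^bsub>heis n a d\<^esub>}"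

definition heis_level ::
  "nat \<Rightarrow> (nat \<Rightarrow> nat \<Rightarrow> int) \<Rightarrow> (nat \<Rightarrow> nat) \<Rightarrow> int \<Rightarrow>
     (qfield, (heis_symbol list \<Rightarrow> qfield) set set) module" where
  "heis_level n a d l = quot_algebra (heis n a d) (heis_level_ideal n a d l)"

definition level_class ::
  "nat \<Rightarrow> (nat \<Rightarrow> nat \<Rightarrow> int) \<Rightarrow> (nat \<Rightarrow> nat) \<Rightarrow> int \<Rightarrow>
     (heis_symbol list \<Rightarrow> qfield) set \<Rightarrow> (heis_symbol list \<Rightarrow> qfield) set set" where
  "level_class n a d l x = heis_level_ideal n a d l +>\<^bsub>heis n a d\<^esub> x"


section \<open>The Weyl algebra of countably infinite rank\<close>

datatype weyl_symbol = X nat int | Partial nat int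

definition weyl_symbols :: "nat \<Rightarrow> weyl_symbol set" where
  "weyl_symbols n = {X i k | i k. i \<in> {1..n} \<and> k > 0} \<union> {Partial i k | i k. i \<in> {1..n} \<and> k > 0}"

abbreviation weyl_free :: "nat \<Rightarrow> (qfield, weyl_symbol list \<Rightarrow> qfield) module" where
  "weyl_free n \<equiv> free_algebra (weyl_symbols n)"

definition weyl_relations :: "nat \<Rightarrow> (weyl_symbol list \<Rightarrow> qfield) set" where
  "weyl_relations n =
     {commutator (weyl_free n) (free_gen (Partial i k)) (free_gen (X i k))
        \<ominus>\<^bsub>weyl_free n\<^esub> \<one>\<^bsub>weyl_free n\<^esub> | i k. i \<in> {1..n} \<and> k > 0} \<union>
     {commutator (weyl_free n) (free_gen (s i k)) (free_gen (t j l)) | s t i j k l.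
        (s, t) \<in> {(X, X), (Partial, X), (Partial, Partial)} \<and>
        i \<in> {1..n} \<and> j \<in> {1..n} \<and> k > 0 \<and> l > 0 \<and> (i, k) \<noteq> (j, l)}"

definition weyl :: "nat \<Rightarrow> (qfield, (weyl_symbol list \<Rightarrow> qfield) set) module" where
  "weyl n = presented_algebra (weyl_symbols n) (weyl_relations n)"

definition weyl_gen :: "nat \<Rightarrow> weyl_symbol \<Rightarrow> (weyl_symbol list \<Rightarrow> qfield) set" where
  "weyl_gen n x = presented_gen (weyl_symbols n) (weyl_relations n) x"

end

theory Submission
  imports Defs "HOL-Computational_Algebra.Formal_Power_Series" "Jordan_Normal_Form.Determinant"
begin

text \<open>
  Modulo \<open>\<gamma>\<^sup>1\<^sup>/\<^sup>2 = q\<^sup>l\<^sup>/\<^sup>2\<close> the right-hand side of the Heisenberg relation becomes the scalar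
  \<open>\<delta>\<^sub>k\<^sub>+\<^sub>m\<^sub>,\<^sub>0 [kl]\<^sub>q \<alpha>\<^sup>k\<^sub>i\<^sub>j\<close>, where \<open>\<alpha>\<^sup>k\<close> is the matrix \<^term>\<open>qa a d k\<close>. What is left of the algebra are
  the \<open>h\<^sub>i\<^sub>k\<close>, whose commutators are scalars: for each \<open>k > 0\<close> the positive and the negative half
  are paired by the matrix \<open>[kl]\<^sub>q \<alpha>\<^sup>k\<close>, and everything else commutes. The Weyl algebra is the same
  with the identity matrix as pairing. So the theorem is a change of basis, which can be undone
  because \<open>[kl]\<^sub>q \<noteq> 0\<close> (as \<open>l \<noteq> 0\<close> and \<open>q\<close> is not a root of unity) and \<open>\<alpha>\<^sup>k\<close> is invertible.

  A presentation is used only through its universal property. A family of elements of an algebra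
  that satisfies the relations is a homomorphism out of the presented algebra
  (\<open>heis_level_universal\<close>, \<open>weyl_universal\<close>), and two homomorphisms that agree on the generators
  are equal (\<open>hom_eqI_on_generators\<close>). Hence it suffices to find a Heisenberg family in the Weyl
  algebra and a Weyl family in the level \<open>l\<close> quotient. They are \<open>h\<^sub>i\<^sub>k = [kl]\<^sub>q \<partial>\<^sub>i\<^sub>k\<close>,
  \<open>h\<^sub>i\<^sub>,\<^sub>-\<^sub>k = \<Sum>\<^sub>m \<alpha>\<^sup>k\<^sub>m\<^sub>i X\<^sub>m\<^sub>k\<close> in one direction (\<open>heisenberg_family_of_weyl_family\<close>) and
  \<open>\<partial>\<^sub>i\<^sub>k = [kl]\<^sub>q\<^sup>-\<^sup>1 h\<^sub>i\<^sub>k\<close>, \<open>X\<^sub>j\<^sub>k = h'\<^sub>j\<^sub>,\<^sub>-\<^sub>k\<close> in the other (\<open>weyl_family_of_heisenberg_family\<close>). The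
  Heisenberg relation is imposed for both orders of the two generators, so the first construction
  also needs \<open>\<alpha>\<^sup>-\<^sup>k\<^sub>i\<^sub>j = \<alpha>\<^sup>k\<^sub>j\<^sub>i\<close>; this is where the symmetry of \<open>(d\<^sub>i a\<^sub>i\<^sub>j)\<close> enters. The two
  homomorphisms are mutually inverse because \<open>\<alpha>\<^sup>k\<close> and its inverse cancel.

  Invertibility of \<open>\<alpha>\<^sup>k\<close> is seen at \<open>q = 1\<close>. Up to invertible diagonal factors, \<open>\<alpha>\<^sup>k\<close> has the entries
  \<open>q\<^sup>m - q\<^sup>-\<^sup>m\<close> with \<open>m = k d\<^sub>i a\<^sub>i\<^sub>j\<close>. Divided by \<open>q\<^sup>1\<^sup>/\<^sup>2 - 1\<close> and multiplied by a power of \<open>q\<^sup>1\<^sup>/\<^sup>2\<close>, they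
  are polynomials in \<open>q\<^sup>1\<^sup>/\<^sup>2\<close> with value \<open>4 k d\<^sub>i a\<^sub>i\<^sub>j\<close> at \<open>1\<close>. The determinant at \<open>1\<close> is nonzero
  because the form of a Cartan matrix of finite type is positive definite, so the determinant is
  a nonzero polynomial (\<open>qa_invertible\<close>).
\<close>

section \<open>Associative algebras and their quotients\<close>

text \<open>
  Unital associative algebras over a field that is a type, which need not be commutative. The
  scalars are not a ring record, so that the arithmetic of \<^typ>\<open>qfield\<close> is available to the
  simplifier.
\<close>
locale assoc_algebra = ring A for A :: "('k::field, 'a, 'm) module_scheme" (structure) +
  assumes smult_closed [simp, intro]: "x \<in> carrier A \<Longrightarrow> c \<odot> x \<in> carrier A"
    and smult_add_left: "x \<in> carrier A \<Longrightarrow> (c + e) \<odot> x = c \<odot> x \<oplus> e \<odot> x"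
    and smult_add_right: "x \<in> carrier A \<Longrightarrow> y \<in> carrier A \<Longrightarrow> c \<odot> (x \<oplus> y) = c \<odot> x \<oplus> c \<odot> y"
    and smult_smult: "x \<in> carrier A \<Longrightarrow> c \<odot> (e \<odot> x) = (c * e) \<odot> x"
    and smult_one [simp]: "x \<in> carrier A \<Longrightarrow> 1 \<odot> x = x"
    and smult_mult_left: "x \<in> carrier A \<Longrightarrow> y \<in> carrier A \<Longrightarrow> (c \<odot> x) \<otimes> y = c \<odot> (x \<otimes> y)"
    and smult_mult_right: "x \<in> carrier A \<Longrightarrow> y \<in> carrier A \<Longrightarrow> x \<otimes> (c \<odot> y) = c \<odot> (x \<otimes> y)"
begin

lemma smult_zero_right [simp]: "c \<odot> \<zero> = \<zero>"
proof -
  have "c \<odot> \<zero> \<oplus> c \<odot> \<zero> = c \<odot> \<zero>"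
    using smult_add_right[of \<zero> \<zero> c] by simp
  then show ?thesis
    using add.l_cancel_one[of "c \<odot> \<zero>" "c \<odot> \<zero>"] by simp
qed

lemma smult_zero_left [simp]: "x \<in> carrier A \<Longrightarrow> 0 \<odot> x = \<zero>"
  using smult_add_left[of x 0 0] add.l_cancel_one[of "0 \<odot> x" "0 \<odot> x"] by simp

lemma smult_uminus: "x \<in> carrier A \<Longrightarrow> (- c) \<odot> x = \<ominus> (c \<odot> x)"
  using smult_add_left[of x "- c" c] by (simp add: minus_equality)

lemma smult_diff: "x \<in> carrier A \<Longrightarrow> (c - e) \<odot> x = c \<odot> x \<ominus> e \<odot> x"
  using smult_add_left[of x c "- e"] by (simp add: smult_uminus minus_eq)

lemma smult_minus_right: "x \<in> carrier A \<Longrightarrow> c \<odot> (\<ominus> x) = \<ominus> (c \<odot> x)"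
  using smult_add_right[of "\<ominus> x" x c] by (simp add: l_neg minus_equality)

lemma smult_finsum:
  "finite F \<Longrightarrow> g \<in> F \<rightarrow> carrier A \<Longrightarrow> c \<odot> (\<Oplus>i\<in>F. g i) = (\<Oplus>i\<in>F. c \<odot> g i)"
  by (induction F rule: finite_induct) (auto simp: smult_add_right Pi_def)

lemma scalar_power: "(c \<odot> \<one>) [^] (m::nat) = (c ^ m) \<odot> \<one>"
  by (induction m) (auto simp: smult_mult_left smult_smult mult.commute)

end

definition algebra_hom ::
  "('k, 'a, 'm) module_scheme \<Rightarrow> ('k, 'b, 'l) module_scheme \<Rightarrow> ('a \<Rightarrow> 'b) set" where
  "algebra_hom A B =
     {\<phi> \<in> Ring.ring_hom A B. \<forall>c. \<forall>x\<in>carrier A. \<phi> (c \<odot>\<^bsub>A\<^esub> x) = c \<odot>\<^bsub>B\<^esub> \<phi> x}"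

lemma algebra_hom_comp:
  "\<phi> \<in> algebra_hom A B \<Longrightarrow> \<psi> \<in> algebra_hom B C \<Longrightarrow> \<psi> \<circ> \<phi> \<in> algebra_hom A C"
  by (auto simp: algebra_hom_def Ring.ring_hom_def Pi_def)

lemma algebra_hom_id: "id \<in> algebra_hom A A"
  by (auto simp: algebra_hom_def Ring.ring_hom_def)

lemma algebra_iso_of_inverse_homs:
  assumes "\<phi> \<in> algebra_hom A B" "\<psi> \<in> algebra_hom B A"
    and "\<And>x. x \<in> carrier A \<Longrightarrow> \<psi> (\<phi> x) = x" "\<And>y. y \<in> carrier B \<Longrightarrow> \<phi> (\<psi> y) = y"
  shows "\<phi> \<in> algebra_iso A B"
proof -
  have "bij_betw \<phi> (carrier A) (carrier B)"
    by (rule bij_betwI[where g = \<psi>])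
      (use assms in \<open>auto simp: algebra_hom_def Ring.ring_hom_def\<close>)
  then show ?thesis
    using assms(1) by (auto simp: algebra_iso_def algebra_hom_def ring_iso_def)
qed

locale algebra_morphism = source: assoc_algebra A + target: assoc_algebra B
  for A :: "('k::field, 'a, 'm) module_scheme" and B :: "('k, 'b, 'l) module_scheme" and \<phi> +
  assumes hom: "\<phi> \<in> algebra_hom A B"
begin

sublocale ring_hom_ring A B \<phi>
  using hom by (intro ring_hom_ringI2 source.ring_axioms target.ring_axioms) (auto simp: algebra_hom_def)

lemma hom_smult [simp]: "x \<in> carrier A \<Longrightarrow> \<phi> (c \<odot>\<^bsub>A\<^esub> x) = c \<odot>\<^bsub>B\<^esub> \<phi> x"
  using hom by (auto simp: algebra_hom_def)

lemma hom_minus [simp]: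
  "x \<in> carrier A \<Longrightarrow> y \<in> carrier A \<Longrightarrow> \<phi> (x \<ominus>\<^bsub>A\<^esub> y) = \<phi> x \<ominus>\<^bsub>B\<^esub> \<phi> y"
  by (simp add: a_minus_def)

lemma hom_commutator [simp]:
  "x \<in> carrier A \<Longrightarrow> y \<in> carrier A \<Longrightarrow> \<phi> (commutator A x y) = commutator B (\<phi> x) (\<phi> y)"
  by (simp add: commutator_def)

lemma hom_power [simp]: "x \<in> carrier A \<Longrightarrow> \<phi> (x [^]\<^bsub>A\<^esub> (m::nat)) = \<phi> x [^]\<^bsub>B\<^esub> m"
  by (induction m) auto

lemma hom_finsum:
  "finite F \<Longrightarrow> g \<in> F \<rightarrow> carrier A \<Longrightarrow> \<phi> (finsum A g F) = finsum B (\<lambda>i. \<phi> (g i)) F"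
  by (induction F rule: finite_induct) (auto simp: Pi_def)

end

text \<open>
  The union in the scalar multiplication of a quotient is over all representatives of a coset.
  It is a single coset because an ideal is closed under scalars: \<open>c \<odot> j = (c \<odot> \<one>) \<otimes> j\<close>.
\<close>
lemma (in assoc_algebra) quot_algebra:
  assumes "ideal J A"
  shows "assoc_algebra (quot_algebra A J)"
    and "(\<lambda>x. J +> x) \<in> algebra_hom A (quot_algebra A J)"
    and "carrier (quot_algebra A J) = (\<lambda>x. J +> x) ` carrier A"
    and "\<zero>\<^bsub>quot_algebra A J\<^esub> = J"
proof -
  interpret J: ideal J A by fact
  let ?Q = "quot_algebra A J"
  have ops: "carrier ?Q = carrier (A Quot J)" "monoid.mult ?Q = monoid.mult (A Quot J)" "one ?Q = one (A Quot J)"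
    "zero ?Q = zero (A Quot J)" "add ?Q = add (A Quot J)"
    by (auto simp: quot_algebra_def ring.extend_def)
  interpret Q: ring "A Quot J" by (rule J.quotient_is_ring)
  show carr: "carrier ?Q = (\<lambda>x. J +> x) ` carrier A"
    by (auto simp: ops FactRing_def A_RCOSETS_def')
  show "\<zero>\<^bsub>?Q\<^esub> = J" by (simp add: ops FactRing_def)
  have smult: "c \<odot>\<^bsub>?Q\<^esub> (J +> x) = J +> (c \<odot> x)" if x: "x \<in> carrier A" for c x
  proof -
    have eq: "J +> (c \<odot> y) = J +> (c \<odot> x)" if y: "y \<in> J +> x" for y
    proof -
      obtain j where j: "j \<in> J" "y = j \<oplus> x" using y by (auto simp: a_r_coset_def')
      have jc: "j \<in> carrier A" using j J.a_Hcarr by blast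
      have "c \<odot> j = (c \<odot> \<one>) \<otimes> j" using jc by (simp add: smult_mult_left)
      then have "c \<odot> j \<in> J" using j J.I_l_closed by simp
      moreover have "c \<odot> y = c \<odot> j \<oplus> c \<odot> x" using j jc x by (simp add: smult_add_right)
      ultimately have "c \<odot> y \<in> J +> (c \<odot> x)" by (auto simp: a_r_coset_def')
      then show ?thesis
        using x J.a_repr_independence'[of "c \<odot> y" "c \<odot> x"] by simp
    qed
    have "x \<in> J +> x" using x J.a_rcos_self by blast
    have "c \<odot>\<^bsub>?Q\<^esub> (J +> x) = (\<Union>y\<in>J +> x. J +> (c \<odot> y))"
      by (simp add: quot_algebra_def ring.extend_def)
    also have "\<dots> = J +> (c \<odot> x)"
      using eq \<open>x \<in> J +> x\<close> by blast
    finally show ?thesis .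
  qed
  have "ring ?Q"
  proof (rule ringI)
    show "abelian_group ?Q"
    proof (rule abelian_groupI)
      fix x assume "x \<in> carrier ?Q"
      then show "\<exists>y\<in>carrier ?Q. y \<oplus>\<^bsub>?Q\<^esub> x = \<zero>\<^bsub>?Q\<^esub>"
        using Q.l_neg Q.a_inv_closed unfolding ops by blast
    qed (use Q.a_assoc Q.a_comm in \<open>simp_all add: ops\<close>)
    show "Group.monoid ?Q"
      by (rule Group.monoid.intro) (auto simp: ops Q.m_assoc)
  qed (auto simp: ops Q.l_distr Q.r_distr)
  then interpret Q': ring ?Q .
  have hom: "(\<lambda>x. J +> x) \<in> Ring.ring_hom A ?Q"
    using J.rcos_ring_hom by (auto simp: Ring.ring_hom_def ops)
  note hm = ring_hom_closed[OF hom] ring_hom_mult[OF hom, symmetric] ring_hom_add[OF hom, symmetric]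
  show "assoc_algebra ?Q"
    by unfold_locales
      (auto simp: carr smult hm smult_add_left smult_add_right smult_smult smult_mult_left smult_mult_right)
  show "(\<lambda>x. J +> x) \<in> algebra_hom A ?Q"
    using hom by (auto simp: algebra_hom_def smult)
qed

lemma (in assoc_algebra) minus_eq_zero_iff:
  assumes "x \<in> carrier A" "y \<in> carrier A"
  shows "x \<ominus> y = \<zero> \<longleftrightarrow> x = y"
proof
  assume "x \<ominus> y = \<zero>"
  then have "(x \<ominus> y) \<oplus> y = y" using assms by simp
  then show "x = y" using assms by (simp add: minus_eq a_assoc l_neg)
qed (use assms in \<open>simp add: minus_eq r_neg\<close>)

lemma (in assoc_algebra) quot_algebra_Idl:
  assumes R: "R \<subseteq> carrier A"
  shows "assoc_algebra (quot_algebra A (Idl R))"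
    and "(\<lambda>x. Idl R +> x) \<in> algebra_hom A (quot_algebra A (Idl R))"
    and "carrier (quot_algebra A (Idl R)) = (\<lambda>x. Idl R +> x) ` carrier A"
    and "r \<in> R \<Longrightarrow> Idl R +> r = \<zero>\<^bsub>quot_algebra A (Idl R)\<^esub>"
proof -
  have J: "ideal (Idl R) A" by (rule genideal_ideal[OF R])
  interpret J: ideal "Idl R" A by (rule J)
  show "assoc_algebra (quot_algebra A (Idl R))"
    "(\<lambda>x. Idl R +> x) \<in> algebra_hom A (quot_algebra A (Idl R))"
    "carrier (quot_algebra A (Idl R)) = (\<lambda>x. Idl R +> x) ` carrier A"
    by (rule quot_algebra[OF J])+
  assume "r \<in> R"
  then have "r \<in> Idl R" using genideal_self[OF R] by blast
  then have "Idl R +> r = Idl R" by (rule J.a_rcos_const)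
  then show "Idl R +> r = \<zero>\<^bsub>quot_algebra A (Idl R)\<^esub>"
    using quot_algebra(4)[OF J] by simp
qed

text \<open>
  The kernel is an ideal, so it contains the ideal generated by \<open>R\<close> as soon as it contains \<open>R\<close>, and
  the homomorphism is constant on cosets.
\<close>
lemma (in algebra_morphism) hom_descends:
  assumes "R \<subseteq> carrier A" and "\<And>r. r \<in> R \<Longrightarrow> \<phi> r = \<zero>\<^bsub>B\<^esub>"
  shows "\<exists>\<psi> \<in> algebra_hom (quot_algebra A (Idl\<^bsub>A\<^esub> R)) B.
           \<forall>x\<in>carrier A. \<psi> (Idl\<^bsub>A\<^esub> R +>\<^bsub>A\<^esub> x) = \<phi> x"
proof -
  let ?J = "Idl\<^bsub>A\<^esub> R"
  let ?Q = "quot_algebra A ?J"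
  have J: "ideal ?J A" by (rule source.genideal_ideal[OF assms(1)])
  interpret J: ideal ?J A by (rule J)
  note Q = source.quot_algebra[OF J]
  interpret Q: assoc_algebra ?Q by (rule Q(1))
  interpret p: algebra_morphism A ?Q "\<lambda>x. ?J +>\<^bsub>A\<^esub> x" by unfold_locales (rule Q(2))
  have "?J \<subseteq> a_kernel A B \<phi>"
  proof (rule source.genideal_minimal[OF kernel_is_ideal])
    show "R \<subseteq> a_kernel A B \<phi>"
      unfolding a_kernel_def' using assms by blast
  qed
  then have zero: "\<phi> j = \<zero>\<^bsub>B\<^esub>" if "j \<in> ?J" for j
    using that unfolding a_kernel_def' by blast
  define \<psi> where "\<psi> Y = the_elem (\<phi> ` Y)" for Y
  have \<psi>: "\<psi> (?J +>\<^bsub>A\<^esub> x) = \<phi> x" if x: "x \<in> carrier A" for x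
  proof -
    have "\<phi> y = \<phi> x" if "y \<in> ?J +>\<^bsub>A\<^esub> x" for y
    proof -
      obtain j where j: "j \<in> ?J" "y = j \<oplus>\<^bsub>A\<^esub> x"
        using \<open>y \<in> ?J +>\<^bsub>A\<^esub> x\<close> unfolding a_r_coset_def' by blast
      have "j \<in> carrier A" using J.a_Hcarr[OF j(1)] .
      then show ?thesis using j x by (simp add: zero)
    qed
    moreover have "x \<in> ?J +>\<^bsub>A\<^esub> x" using x J.a_rcos_self by blast
    ultimately have "\<phi> ` (?J +>\<^bsub>A\<^esub> x) = {\<phi> x}" by blast
    then show ?thesis by (simp add: \<psi>_def)
  qed
  have "\<psi> \<in> algebra_hom ?Q B"
    by (auto simp: algebra_hom_def Ring.ring_hom_def Q(3) \<psi> simp flip: p.hom_smult p.hom_mult p.hom_add p.hom_one)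
  with \<psi> show ?thesis by blast
qed

section \<open>Free algebras\<close>

definition word_monomial :: "'x list \<Rightarrow> 'x list \<Rightarrow> 'k::field" where
  "word_monomial w = (\<lambda>v. if v = w then 1 else 0)"

lemma free_gen_eq_word_monomial: "free_gen x = word_monomial [x]"
  by (simp add: free_gen_def word_monomial_def)

lemma free_algebra_support: "f \<in> carrier (free_algebra S) \<Longrightarrow> f w \<noteq> 0 \<Longrightarrow> w \<in> lists S"
  unfolding free_algebra_def partial_object.simps by (drule CollectD, erule conjE, erule subsetD, rule CollectI)

lemma free_algebra_mult_closed:
  assumes f: "f \<in> carrier (free_algebra S)" and g: "g \<in> carrier (free_algebra S)"
  shows "f \<otimes>\<^bsub>free_algebra S\<^esub> g \<in> carrier (free_algebra S)"
proof -
  let ?C = "(\<lambda>(u, v). u @ v) ` ({w. f w \<noteq> 0} \<times> {w. g w \<noteq> 0})"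
  let ?h = "\<lambda>w. \<Sum>i\<le>length w. f (take i w) * g (drop i w)"
  have sub: "{w. ?h w \<noteq> 0} \<subseteq> ?C"
  proof
    fix w assume "w \<in> {w. ?h w \<noteq> 0}"
    then obtain i where "f (take i w) * g (drop i w) \<noteq> 0"
      by (auto elim: sum.not_neutral_contains_not_neutral)
    then show "w \<in> ?C"
      by (intro image_eqI[of _ _ "(take i w, drop i w)"]) auto
  qed
  moreover have "finite ?C"
    using f g by (auto simp: free_algebra_def)
  moreover have "?C \<subseteq> lists S"
  proof -
    have *: "u @ v \<in> lists S" if "f u \<noteq> 0" "g v \<noteq> 0" for u v
    proof -
      have "u \<in> lists S"
        by (rule free_algebra_support[OF f that(1)])
      moreover have "v \<in> lists S"
        by (rule free_algebra_support[OF g that(2)])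
      ultimately show ?thesis by simp
    qed
    show ?thesis
    proof
      fix w assume "w \<in> ?C"
      then obtain u v where "f u \<noteq> 0" "g v \<noteq> 0" "w = u @ v" by auto
      then show "w \<in> lists S" using *[of u v] by simp
    qed
  qed
  ultimately show ?thesis
    using finite_subset[OF sub] by (auto simp: free_algebra_def)
qed

text \<open>
  Both sides are the sum over all ways to cut a word into three pieces; the reindexing is the
  one that proves associativity for formal power series.
\<close>
lemma free_algebra_mult_assoc:
  fixes f g h :: "'x list \<Rightarrow> 'k::field"
  shows "(f \<otimes>\<^bsub>free_algebra S\<^esub> g) \<otimes>\<^bsub>free_algebra S\<^esub> h
       = f \<otimes>\<^bsub>free_algebra S\<^esub> (g \<otimes>\<^bsub>free_algebra S\<^esub> h)"
proof
  fix w :: "'x list"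
  let ?n = "length w"
  let ?F = "\<lambda>i j (k::nat). f (take i w) * g (take j (drop i w)) * h (drop (i + j) w)"
  have "((f \<otimes>\<^bsub>free_algebra S\<^esub> g) \<otimes>\<^bsub>free_algebra S\<^esub> h) w
      = (\<Sum>j=0..?n. \<Sum>i=0..j. ?F i (j - i) (?n - j))"
    by (auto simp: free_algebra_def sum_distrib_right atLeast0AtMost drop_take min_def
        intro!: sum.cong)
  also have "\<dots> = (\<Sum>j=0..?n. \<Sum>i=0..?n - j. ?F j i (?n - j - i))"
    by (rule fps_mult_assoc_lemma)
  also have "\<dots> = (f \<otimes>\<^bsub>free_algebra S\<^esub> (g \<otimes>\<^bsub>free_algebra S\<^esub> h)) w"
    by (auto simp: free_algebra_def sum_distrib_left atLeast0AtMost mult.assoc add.commute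
        intro!: sum.cong)
  finally show "((f \<otimes>\<^bsub>free_algebra S\<^esub> g) \<otimes>\<^bsub>free_algebra S\<^esub> h) w
      = (f \<otimes>\<^bsub>free_algebra S\<^esub> (g \<otimes>\<^bsub>free_algebra S\<^esub> h)) w" .
qed

lemma word_monomial_mult_left:
  "word_monomial [] \<otimes>\<^bsub>free_algebra S\<^esub> f = (f :: 'x list \<Rightarrow> 'k::field)"
proof
  fix w :: "'x list"
  have "(\<Sum>i\<le>length w. word_monomial [] (take i w) * f (drop i w))
      = (\<Sum>i\<in>{0}. word_monomial [] (take i w) * f (drop i w))"
    by (rule sum.mono_neutral_right) (auto simp: word_monomial_def)
  then show "(word_monomial [] \<otimes>\<^bsub>free_algebra S\<^esub> f) w = f w"
    by (simp add: free_algebra_def word_monomial_def)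
qed

lemma word_monomial_mult_right:
  "f \<otimes>\<^bsub>free_algebra S\<^esub> word_monomial [] = (f :: 'x list \<Rightarrow> 'k::field)"
proof
  fix w :: "'x list"
  have "(\<Sum>i\<le>length w. f (take i w) * word_monomial [] (drop i w))
      = (\<Sum>i\<in>{length w}. f (take i w) * word_monomial [] (drop i w))"
    by (rule sum.mono_neutral_right) (auto simp: word_monomial_def)
  then show "(f \<otimes>\<^bsub>free_algebra S\<^esub> word_monomial []) w = f w"
    by (simp add: free_algebra_def word_monomial_def)
qed

lemma word_monomial_mult:
  "word_monomial u \<otimes>\<^bsub>free_algebra S\<^esub> word_monomial v
     = (word_monomial (u @ v) :: 'x list \<Rightarrow> 'k::field)"
proof
  fix w :: "'x list"
  have *: "(\<Sum>i\<le>length w. word_monomial u (take i w) * word_monomial v (drop i w))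
      = (\<Sum>i\<in>(if w = u @ v then {length u} else {}).
           word_monomial u (take i w) * (word_monomial v (drop i w) :: 'k))"
  proof (rule sum.mono_neutral_right)
    show "\<forall>i\<in>{..length w} - (if w = u @ v then {length u} else {}).
            word_monomial u (take i w) * (word_monomial v (drop i w) :: 'k) = 0"
    proof
      fix i assume i: "i \<in> {..length w} - (if w = u @ v then {length u} else {})"
      have "\<not> (take i w = u \<and> drop i w = v)"
      proof
        assume *: "take i w = u \<and> drop i w = v"
        then have "w = u @ v" by (metis append_take_drop_id)
        moreover have "i = length u"
        proof -
          have "length (take i w) = length u" using * by simp
          then show ?thesis using i by simp
        qed
        ultimately show False using i by simp
      qed
      then show "word_monomial u (take i w) * (word_monomial v (drop i w) :: 'k) = 0"
        by (auto simp: word_monomial_def)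
    qed
  qed auto
  show "(word_monomial u \<otimes>\<^bsub>free_algebra S\<^esub> word_monomial v) w
      = (word_monomial (u @ v) w :: 'k)"
    using * by (auto simp: free_algebra_def word_monomial_def)
qed

lemma one_free_algebra: "\<one>\<^bsub>free_algebra S\<^esub> = word_monomial []"
  by (simp add: free_algebra_def word_monomial_def)

lemma word_monomial_closed: "w \<in> lists S \<Longrightarrow> word_monomial w \<in> carrier (free_algebra S)"
  by (auto simp: free_algebra_def word_monomial_def)

lemma free_gen_closed: "x \<in> S \<Longrightarrow> free_gen x \<in> carrier (free_algebra S)"
  by (simp add: free_gen_eq_word_monomial word_monomial_closed)

lemma free_algebra_lincomb_closed:
  assumes "f \<in> carrier (free_algebra S)" "g \<in> carrier (free_algebra S)"
  shows "(\<lambda>w. c * f w + e * g w) \<in> carrier (free_algebra S)"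
proof -
  have sub: "{w. c * f w + e * g w \<noteq> 0} \<subseteq> {w. f w \<noteq> 0} \<union> {w. g w \<noteq> 0}" by auto
  then show ?thesis
    using assms finite_subset[OF sub] by (auto simp: free_algebra_def)
qed

lemma assoc_algebra_free_algebra:
  "assoc_algebra (free_algebra S :: ('k::field, 'x list \<Rightarrow> 'k) module)"
proof -
  let ?F = "free_algebra S :: ('k::field, 'x list \<Rightarrow> 'k) module"
  have plus: "f \<oplus>\<^bsub>?F\<^esub> g = (\<lambda>w. f w + g w)" and zero: "\<zero>\<^bsub>?F\<^esub> = (\<lambda>w. 0)"
    and scal: "c \<odot>\<^bsub>?F\<^esub> f = (\<lambda>w. c * f w)" for f g c
    by (auto simp: free_algebra_def)
  have mult: "f \<otimes>\<^bsub>?F\<^esub> g = (\<lambda>w. \<Sum>i\<le>length w. f (take i w) * g (drop i w))" for f g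
    by (auto simp: free_algebra_def)
  have "ring ?F"
  proof (rule ringI)
    show "abelian_group ?F"
    proof (rule abelian_groupI)
      fix x assume x: "x \<in> carrier ?F"
      show "\<exists>y\<in>carrier ?F. y \<oplus>\<^bsub>?F\<^esub> x = \<zero>\<^bsub>?F\<^esub>"
        using free_algebra_lincomb_closed[OF x x, of 0 "-1"]
        by (intro bexI[of _ "\<lambda>w. - x w"]) (auto simp: plus zero)
      fix y assume y: "y \<in> carrier ?F"
      show "x \<oplus>\<^bsub>?F\<^esub> y \<in> carrier ?F"
        using free_algebra_lincomb_closed[OF x y, of 1 1] by (simp add: plus)
    qed (auto simp: plus zero add_ac, simp add: free_algebra_def)
    show "Group.monoid ?F"
      by unfold_locales
        (auto simp: free_algebra_mult_closed free_algebra_mult_assoc one_free_algebra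
          word_monomial_closed word_monomial_mult_left word_monomial_mult_right)
  qed (auto simp: plus mult distrib_left distrib_right sum.distrib)
  then interpret F: ring ?F .
  show ?thesis
  proof
    fix x :: "'x list \<Rightarrow> 'k" and c :: 'k assume x: "x \<in> carrier ?F"
    show "c \<odot>\<^bsub>?F\<^esub> x \<in> carrier ?F"
      using free_algebra_lincomb_closed[OF x x, of c 0] by (simp add: scal)
  qed (auto simp: plus scal mult sum_distrib_left algebra_simps)
qed

text \<open>
  Words span the free algebra. Linear statements about it, and multiplicativity, are reduced
  to words by this induction.
\<close>
lemma free_algebra_induct [consumes 1, case_names zero add]:
  fixes u :: "'x list \<Rightarrow> 'k::field"
  assumes u: "u \<in> carrier (free_algebra S)"
    and zero: "P \<zero>\<^bsub>free_algebra S\<^esub>"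
    and add: "\<And>u c w. u \<in> carrier (free_algebra S) \<Longrightarrow> w \<in> lists S \<Longrightarrow> P u \<Longrightarrow>
                P (u \<oplus>\<^bsub>free_algebra S\<^esub> c \<odot>\<^bsub>free_algebra S\<^esub> word_monomial w)"
  shows "P u"
proof -
  have "P u" if "finite T" "{w. u w \<noteq> 0} \<subseteq> T" "T \<subseteq> lists S" for T u
    using that
  proof (induction T arbitrary: u rule: finite_induct)
    case empty
    then have "u = \<zero>\<^bsub>free_algebra S\<^esub>" by (auto simp: free_algebra_def)
    then show ?case using zero by simp
  next
    case (insert w T)
    let ?u = "u(w := 0)"
    have supp: "{v. ?u v \<noteq> 0} \<subseteq> T" using insert.prems by auto
    have "P (?u \<oplus>\<^bsub>free_algebra S\<^esub> u w \<odot>\<^bsub>free_algebra S\<^esub> word_monomial w)"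
    proof (rule add)
      show "P ?u" by (rule insert.IH[OF supp]) (use insert.prems in simp)
      show "?u \<in> carrier (free_algebra S)"
        using supp insert.prems finite_subset[OF supp \<open>finite T\<close>] by (auto simp: free_algebra_def)
      show "w \<in> lists S" using insert.prems by simp
    qed
    moreover have "?u \<oplus>\<^bsub>free_algebra S\<^esub> u w \<odot>\<^bsub>free_algebra S\<^esub> word_monomial w = u"
      by (auto simp: free_algebra_def word_monomial_def)
    ultimately show ?case by simp
  qed
  then show ?thesis using u by (auto simp: free_algebra_def)
qed

definition word_eval :: "('b, 'm) ring_scheme \<Rightarrow> ('x \<Rightarrow> 'b) \<Rightarrow> 'x list \<Rightarrow> 'b" where
  "word_eval B f w = foldr (\<lambda>x y. f x \<otimes>\<^bsub>B\<^esub> y) w \<one>\<^bsub>B\<^esub>"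

text \<open>The homomorphism that substitutes \<open>f x\<close> for each generator \<open>x\<close>.\<close>
definition free_lift ::
  "('k::field, 'b, 'm) module_scheme \<Rightarrow> ('x \<Rightarrow> 'b) \<Rightarrow> ('x list \<Rightarrow> 'k) \<Rightarrow> 'b" where
  "free_lift B f u = (\<Oplus>\<^bsub>B\<^esub>w\<in>{w. u w \<noteq> 0}. u w \<odot>\<^bsub>B\<^esub> word_eval B f w)"

context assoc_algebra
begin

lemma word_eval_closed [simp]:
  "f \<in> S \<rightarrow> carrier A \<Longrightarrow> w \<in> lists S \<Longrightarrow> word_eval A f w \<in> carrier A"
  by (induction w) (auto simp: word_eval_def)

lemma word_eval_append:
  "f \<in> S \<rightarrow> carrier A \<Longrightarrow> u \<in> lists S \<Longrightarrow> v \<in> lists S \<Longrightarrow>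
     word_eval A f (u @ v) = word_eval A f u \<otimes> word_eval A f v"
proof (induction u)
  case Nil
  then show ?case using word_eval_closed[of f S v] by (simp add: word_eval_def)
next
  case (Cons x u)
  have "f x \<in> carrier A" "word_eval A f u \<in> carrier A" "word_eval A f v \<in> carrier A"
    using Cons.prems word_eval_closed[of f S] by auto
  then show ?case using Cons by (simp add: word_eval_def m_assoc)
qed

text \<open>
  The sum over the support is inconvenient because the support of a sum or a multiple may shrink;
  any larger finite set of words serves as well.
\<close>
lemma free_lift_superset:
  assumes "f \<in> S \<rightarrow> carrier A" "finite T" "{w. u w \<noteq> 0} \<subseteq> T" "T \<subseteq> lists S"
  shows "free_lift A f u = (\<Oplus>w\<in>T. u w \<odot> word_eval A f w)"
  unfolding free_lift_def
proof (rule add.finprod_mono_neutral_cong_left)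
  have "word_eval A f w \<in> carrier A" if "w \<in> T" for w
    using that assms by (intro word_eval_closed) auto
  then show "\<And>w. w \<in> T - {w. u w \<noteq> 0} \<Longrightarrow> u w \<odot> word_eval A f w = \<zero>"
    and "(\<lambda>w. u w \<odot> word_eval A f w) \<in> T \<rightarrow> carrier A"
    by auto
qed (use assms in auto)

lemma free_lift_word_monomial:
  assumes "f \<in> S \<rightarrow> carrier A" "w \<in> lists S"
  shows "free_lift A f (word_monomial w) = word_eval A f w"
proof -
  have "free_lift A f (word_monomial w) = (\<Oplus>v\<in>{w}. word_monomial w v \<odot> word_eval A f v)"
    by (rule free_lift_superset) (use assms in \<open>auto simp: word_monomial_def split: if_splits\<close>)
  then show ?thesis
    using assms word_eval_closed[OF assms] by (simp add: word_monomial_def finsum_singleton)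
qed

lemma free_lift_free_gen:
  "f \<in> S \<rightarrow> carrier A \<Longrightarrow> x \<in> S \<Longrightarrow> free_lift A f (free_gen x) = f x"
  by (subst free_gen_eq_word_monomial, subst free_lift_word_monomial[of _ S])
    (auto simp: word_eval_def Pi_def)

text \<open>
  The universal property of the free algebra. Linearity is a matter of finite sums. For a product,
  one factor after the other is reduced to a word, and on words substitution turns concatenation
  into multiplication.
\<close>
theorem free_lift_hom:
  fixes f :: "'x \<Rightarrow> 'a"
  assumes f: "f \<in> S \<rightarrow> carrier A"
  shows "free_lift A f \<in> algebra_hom (free_algebra S) A"
proof -
  let ?F = "free_algebra S :: ('k, 'x list \<Rightarrow> 'k) module"
  let ?\<phi> = "free_lift A f"
  interpret F: assoc_algebra ?F by (rule assoc_algebra_free_algebra)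
  note ev = word_eval_closed[OF f]
  have supp: "finite {w. u w \<noteq> 0}" "{w. u w \<noteq> 0} \<subseteq> lists S" if "u \<in> carrier ?F" for u
    using that by (simp_all add: free_algebra_def)
  have ev_supp: "word_eval A f w \<in> carrier A" if "u \<in> carrier ?F" "u w \<noteq> 0" for u w
    by (rule ev[OF free_algebra_support[OF that]])
  have closed: "?\<phi> u \<in> carrier A" if "u \<in> carrier ?F" for u
    unfolding free_lift_def by (rule finsum_closed) (use that ev_supp in auto)
  have add: "?\<phi> (u \<oplus>\<^bsub>?F\<^esub> v) = ?\<phi> u \<oplus> ?\<phi> v" if u: "u \<in> carrier ?F" and v: "v \<in> carrier ?F" for u v
  proof -
    let ?T = "{w. u w \<noteq> 0} \<union> {w. v w \<noteq> 0}"
    have T: "finite ?T" "?T \<subseteq> lists S"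
      using supp[OF u] supp[OF v] by (simp_all only: finite_Un Un_least)
    have evT: "word_eval A f w \<in> carrier A" if "w \<in> ?T" for w
      using that ev_supp[OF u] ev_supp[OF v] by blast
    have "?\<phi> (u \<oplus>\<^bsub>?F\<^esub> v) = (\<Oplus>w\<in>?T. (u \<oplus>\<^bsub>?F\<^esub> v) w \<odot> word_eval A f w)"
      by (rule free_lift_superset[OF f T(1) _ T(2)]) (auto simp: free_algebra_def)
    also have "\<dots> = (\<Oplus>w\<in>?T. u w \<odot> word_eval A f w \<oplus> v w \<odot> word_eval A f w)"
      by (rule finsum_cong') (use evT in \<open>simp_all add: free_algebra_def smult_add_left Pi_def\<close>)
    also have "\<dots> = (\<Oplus>w\<in>?T. u w \<odot> word_eval A f w) \<oplus> (\<Oplus>w\<in>?T. v w \<odot> word_eval A f w)"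
      by (rule finsum_addf) (use evT in auto)
    also have "\<dots> = ?\<phi> u \<oplus> ?\<phi> v"
      using free_lift_superset[OF f T(1) _ T(2), of u] free_lift_superset[OF f T(1) _ T(2), of v] by auto
    finally show ?thesis .
  qed
  have smult: "?\<phi> (c \<odot>\<^bsub>?F\<^esub> u) = c \<odot> ?\<phi> u" if u: "u \<in> carrier ?F" for c u
  proof -
    let ?T = "{w. u w \<noteq> 0}"
    have "?\<phi> (c \<odot>\<^bsub>?F\<^esub> u) = (\<Oplus>w\<in>?T. (c * u w) \<odot> word_eval A f w)"
      using free_lift_superset[OF f supp(1)[OF u] _ supp(2)[OF u], of "c \<odot>\<^bsub>?F\<^esub> u"]
      by (auto simp: free_algebra_def)
    also have "\<dots> = (\<Oplus>w\<in>?T. c \<odot> (u w \<odot> word_eval A f w))"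
      by (rule finsum_cong') (use ev_supp[OF u] in \<open>auto simp: smult_smult\<close>)
    also have "\<dots> = c \<odot> ?\<phi> u"
      unfolding free_lift_def
      by (rule smult_finsum[symmetric]) (use supp(1)[OF u] ev_supp[OF u] in auto)
    finally show ?thesis .
  qed
  have zero: "?\<phi> \<zero>\<^bsub>?F\<^esub> = \<zero>"
    by (simp add: free_lift_def free_algebra_def)
  have mono: "?\<phi> (word_monomial w) = word_eval A f w" if "w \<in> lists S" for w
    using that by (rule free_lift_word_monomial[OF f])
  have mult_mono: "?\<phi> (word_monomial w \<otimes>\<^bsub>?F\<^esub> v) = word_eval A f w \<otimes> ?\<phi> v"
    if v: "v \<in> carrier ?F" and w: "w \<in> lists S" for v w
    using v
  proof (induction v rule: free_algebra_induct)
    case zero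
    then show ?case using w by (simp add: \<open>?\<phi> \<zero>\<^bsub>?F\<^esub> = \<zero>\<close> word_monomial_closed ev)
  next
    case (add v c y)
    have cl: "word_monomial w \<in> carrier ?F" "word_monomial y \<in> carrier ?F"
        "word_monomial (w @ y) \<in> carrier ?F"
      using w add by (auto intro!: word_monomial_closed)
    have "word_monomial w \<otimes>\<^bsub>?F\<^esub> (v \<oplus>\<^bsub>?F\<^esub> c \<odot>\<^bsub>?F\<^esub> word_monomial y)
        = word_monomial w \<otimes>\<^bsub>?F\<^esub> v \<oplus>\<^bsub>?F\<^esub> c \<odot>\<^bsub>?F\<^esub> word_monomial (w @ y)"
      using cl add by (simp add: F.r_distr F.smult_mult_right word_monomial_mult)
    moreover have "w @ y \<in> lists S" using w add by auto
    ultimately show ?case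
      using cl add w \<open>\<And>u v. u \<in> carrier ?F \<Longrightarrow> v \<in> carrier ?F \<Longrightarrow> ?\<phi> (u \<oplus>\<^bsub>?F\<^esub> v) = ?\<phi> u \<oplus> ?\<phi> v\<close>
      by (simp add: smult mono word_eval_append[OF f] r_distr smult_mult_right ev closed)
  qed
  have mult: "?\<phi> (u \<otimes>\<^bsub>?F\<^esub> v) = ?\<phi> u \<otimes> ?\<phi> v" if u: "u \<in> carrier ?F" and v: "v \<in> carrier ?F" for u v
    using u
  proof (induction u rule: free_algebra_induct)
    case zero
    then show ?case using v by (simp add: \<open>?\<phi> \<zero>\<^bsub>?F\<^esub> = \<zero>\<close> closed)
  next
    case (add u c y)
    have cl: "word_monomial y \<in> carrier ?F"
      using add by (auto intro!: word_monomial_closed)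
    show ?case
      using cl add v \<open>\<And>u v. u \<in> carrier ?F \<Longrightarrow> v \<in> carrier ?F \<Longrightarrow> ?\<phi> (u \<oplus>\<^bsub>?F\<^esub> v) = ?\<phi> u \<oplus> ?\<phi> v\<close>
      by (simp add: F.l_distr F.smult_mult_left smult mono mult_mono l_distr smult_mult_left ev closed)
  qed
  show ?thesis
    using closed add smult mult mono[of "[]"]
    by (auto simp: algebra_hom_def Ring.ring_hom_def one_free_algebra word_eval_def)
qed

end

lemma free_algebra_hom_eqI:
  fixes B :: "('k::field, 'b, 'm) module_scheme" and \<phi> \<psi> :: "('x list \<Rightarrow> 'k) \<Rightarrow> 'b"
  assumes B: "assoc_algebra B"
    and \<phi>: "\<phi> \<in> algebra_hom (free_algebra S) B" and \<psi>: "\<psi> \<in> algebra_hom (free_algebra S) B"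
    and eq: "\<And>x. x \<in> S \<Longrightarrow> \<phi> (free_gen x) = \<psi> (free_gen x)"
    and u: "u \<in> carrier (free_algebra S)"
  shows "\<phi> u = \<psi> u"
proof -
  interpret F: assoc_algebra "free_algebra S" by (rule assoc_algebra_free_algebra)
  interpret B: assoc_algebra B by (rule B)
  interpret \<phi>: algebra_morphism "free_algebra S" B \<phi> by unfold_locales (rule \<phi>)
  interpret \<psi>: algebra_morphism "free_algebra S" B \<psi> by unfold_locales (rule \<psi>)
  have mono: "\<phi> (word_monomial w) = \<psi> (word_monomial w)" if "w \<in> lists S" for w
    using that
  proof (induction w)
    case Nil
    then show ?case by (simp flip: one_free_algebra[of S])
  next
    case (Cons x w)
    then have "x \<in> S" "w \<in> lists S" by auto
    moreover have "(word_monomial (x # w) :: 'x list \<Rightarrow> 'k)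
      = free_gen x \<otimes>\<^bsub>free_algebra S\<^esub> word_monomial w"
      by (simp add: free_gen_eq_word_monomial word_monomial_mult)
    ultimately show ?case
      using Cons.IH by (simp add: eq free_gen_closed word_monomial_closed)
  qed
  show ?thesis
    using u by (induction u rule: free_algebra_induct) (simp_all add: mono word_monomial_closed)
qed

section \<open>Algebras given by generators and relations\<close>

definition presented_proj ::
  "'x set \<Rightarrow> ('x list \<Rightarrow> 'k::field) set \<Rightarrow> ('x list \<Rightarrow> 'k) \<Rightarrow> ('x list \<Rightarrow> 'k) set" where
  "presented_proj S R u = (Idl\<^bsub>free_algebra S\<^esub> R) +>\<^bsub>free_algebra S\<^esub> u"

lemma presented_algebra:
  assumes R: "R \<subseteq> carrier (free_algebra S)"
  shows "assoc_algebra (presented_algebra S R)"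
    and "presented_proj S R \<in> algebra_hom (free_algebra S) (presented_algebra S R)"
    and "carrier (presented_algebra S R) = presented_proj S R ` carrier (free_algebra S)"
    and "r \<in> R \<Longrightarrow> presented_proj S R r = \<zero>\<^bsub>presented_algebra S R\<^esub>"
  using assoc_algebra.quot_algebra_Idl[OF assoc_algebra_free_algebra R]
  by (simp_all add: presented_algebra_def presented_proj_def[abs_def])

lemma presented_algebra_universal:
  assumes B: "assoc_algebra B" and R: "R \<subseteq> carrier (free_algebra S)" and f: "f \<in> S \<rightarrow> carrier B"
    and rel: "\<And>r. r \<in> R \<Longrightarrow> free_lift B f r = \<zero>\<^bsub>B\<^esub>"
  shows "\<exists>\<psi> \<in> algebra_hom (presented_algebra S R) B.
    \<forall>u\<in>carrier (free_algebra S). \<psi> (presented_proj S R u) = free_lift B f u"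
proof -
  interpret F: assoc_algebra "free_algebra S" by (rule assoc_algebra_free_algebra)
  interpret B: assoc_algebra B by (rule B)
  interpret lift: algebra_morphism "free_algebra S" B "free_lift B f"
    by unfold_locales (rule B.free_lift_hom[OF f])
  show ?thesis
    using lift.hom_descends[OF R rel] by (simp add: presented_algebra_def presented_proj_def)
qed

text \<open>
  Homomorphisms out of an algebra generated by the images of \<open>S\<close> are determined on these images,
  by composing with the surjection from the free algebra. Iterated quotients are
  covered without reference to the intermediate ones.
\<close>
lemma hom_eqI_on_generators:
  fixes A :: "('k::field, 'a, 'm) module_scheme" and B :: "('k, 'b, 'l) module_scheme"
  assumes B: "assoc_algebra B"
    and \<pi>: "\<pi> \<in> algebra_hom (free_algebra S) A" "carrier A = \<pi> ` carrier (free_algebra S)"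
    and \<phi>: "\<phi> \<in> algebra_hom A B" and \<psi>: "\<psi> \<in> algebra_hom A B"
    and eq: "\<And>s. s \<in> S \<Longrightarrow> \<phi> (\<pi> (free_gen s)) = \<psi> (\<pi> (free_gen s))"
    and x: "x \<in> carrier A"
  shows "\<phi> x = \<psi> x"
proof -
  obtain u where u: "u \<in> carrier (free_algebra S)" "x = \<pi> u" using x \<pi>(2) by blast
  have "(\<phi> \<circ> \<pi>) u = (\<psi> \<circ> \<pi>) u"
    by (rule free_algebra_hom_eqI[OF B algebra_hom_comp[OF \<pi>(1) \<phi>] algebra_hom_comp[OF \<pi>(1) \<psi>]])
      (simp_all add: eq u(1))
  then show ?thesis using u by simp
qed

section \<open>Commutators, Heisenberg families and Weyl families\<close>

context assoc_algebra
begin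

lemma commutator_closed [simp]:
  "x \<in> carrier A \<Longrightarrow> y \<in> carrier A \<Longrightarrow> commutator A x y \<in> carrier A"
  by (simp add: commutator_def)

lemma commutator_swap:
  "x \<in> carrier A \<Longrightarrow> y \<in> carrier A \<Longrightarrow> commutator A y x = \<ominus> commutator A x y"
  by (simp add: commutator_def minus_eq minus_add a_comm)

lemma commutator_add_right:
  assumes "x \<in> carrier A" "y \<in> carrier A" "z \<in> carrier A"
  shows "commutator A x (y \<oplus> z) = commutator A x y \<oplus> commutator A x z"
  using assms by (simp add: commutator_def minus_eq r_distr l_distr minus_add a_ac)

lemma commutator_smult_right:
  assumes "x \<in> carrier A" "y \<in> carrier A"
  shows "commutator A x (c \<odot> y) = c \<odot> commutator A x y"
  using assms
  by (simp add: commutator_def minus_eq smult_mult_left smult_mult_right smult_add_right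
      smult_minus_right)

lemma commutator_smult_left:
  assumes "x \<in> carrier A" "y \<in> carrier A"
  shows "commutator A (c \<odot> x) y = c \<odot> commutator A x y"
  using assms
  by (simp add: commutator_def minus_eq smult_mult_left smult_mult_right smult_add_right
      smult_minus_right)

lemma commutator_zero_right: "x \<in> carrier A \<Longrightarrow> commutator A x \<zero> = \<zero>"
  using r_neg[OF zero_closed] by (simp add: commutator_def a_minus_def)

lemma commutator_self: "x \<in> carrier A \<Longrightarrow> commutator A x x = \<zero>"
  using r_neg[of "x \<otimes> x"] by (simp add: commutator_def a_minus_def)

lemma commutator_scalar_left: "x \<in> carrier A \<Longrightarrow> commutator A (c \<odot> \<one>) x = \<zero>"
  using r_neg[of "c \<odot> x"] by (simp add: commutator_def smult_mult_left smult_mult_right a_minus_def)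

lemma commutator_swap_scalar:
  "x \<in> carrier A \<Longrightarrow> y \<in> carrier A \<Longrightarrow> commutator A x y = c \<odot> \<one> \<Longrightarrow>
     commutator A y x = (- c) \<odot> \<one>"
  using commutator_swap[of x y] by (simp add: smult_uminus)

lemma lincomb_closed [simp]:
  "x \<in> F \<rightarrow> carrier A \<Longrightarrow> (\<Oplus>i\<in>F. c i \<odot> x i) \<in> carrier A"
  by (rule finsum_closed) auto

text \<open>
  All commutators that occur are scalars, so those of linear combinations are computed in the
  field.
\<close>
lemma commutator_lincomb_right:
  assumes "finite F" "x \<in> carrier A" "y \<in> F \<rightarrow> carrier A"
    and "\<And>i. i \<in> F \<Longrightarrow> commutator A x (y i) = s i \<odot> \<one>"
  shows "commutator A x (\<Oplus>i\<in>F. c i \<odot> y i) = (\<Sum>i\<in>F. c i * s i) \<odot> \<one>"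
  using assms
proof (induction F rule: finite_induct)
  case empty
  then show ?case by (simp add: commutator_zero_right)
next
  case (insert i F)
  then have cl: "y i \<in> carrier A" "y \<in> F \<rightarrow> carrier A" by auto
  then have "(\<Oplus>i\<in>insert i F. c i \<odot> y i) = c i \<odot> y i \<oplus> (\<Oplus>i\<in>F. c i \<odot> y i)"
    using insert by (intro finsum_insert) auto
  then show ?case
    using insert cl
    by (simp add: commutator_add_right commutator_smult_right smult_smult smult_add_left)
qed

lemma commutator_lincomb_left:
  assumes "finite F" "y \<in> carrier A" "x \<in> F \<rightarrow> carrier A"
    and "\<And>i. i \<in> F \<Longrightarrow> commutator A (x i) y = s i \<odot> \<one>"
  shows "commutator A (\<Oplus>i\<in>F. c i \<odot> x i) y = (\<Sum>i\<in>F. c i * s i) \<odot> \<one>"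
proof -
  have "commutator A y (\<Oplus>i\<in>F. c i \<odot> x i) = (\<Sum>i\<in>F. c i * - s i) \<odot> \<one>"
    by (rule commutator_lincomb_right) (use assms in \<open>auto intro!: commutator_swap_scalar\<close>)
  then have "commutator A (\<Oplus>i\<in>F. c i \<odot> x i) y = (- (\<Sum>i\<in>F. c i * - s i)) \<odot> \<one>"
    using assms by (intro commutator_swap_scalar) auto
  then show ?thesis by (simp add: sum_negf)
qed

lemma lincomb_lincomb:
  assumes "finite M" "finite F" "x \<in> F \<rightarrow> carrier A"
  shows "(\<Oplus>m\<in>M. c m \<odot> (\<Oplus>r\<in>F. e r m \<odot> x r)) = (\<Oplus>r\<in>F. (\<Sum>m\<in>M. e r m * c m) \<odot> x r)"
  using assms(1)
proof (induction M rule: finite_induct)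
  case empty
  have "(\<Oplus>r\<in>F. (0 :: 'k) \<odot> x r) = (\<Oplus>r\<in>F. \<zero>)"
    by (rule finsum_cong') (use assms in \<open>auto intro!: smult_zero_left\<close>)
  then show ?case by simp
next
  case (insert m M)
  have "(\<Oplus>m\<in>insert m M. c m \<odot> (\<Oplus>r\<in>F. e r m \<odot> x r))
      = c m \<odot> (\<Oplus>r\<in>F. e r m \<odot> x r) \<oplus> (\<Oplus>m\<in>M. c m \<odot> (\<Oplus>r\<in>F. e r m \<odot> x r))"
    using insert assms by (intro finsum_insert) auto
  also have "c m \<odot> (\<Oplus>r\<in>F. e r m \<odot> x r) = (\<Oplus>r\<in>F. c m \<odot> (e r m \<odot> x r))"
    using assms by (intro smult_finsum) auto
  also have "\<dots> \<oplus> (\<Oplus>m\<in>M. c m \<odot> (\<Oplus>r\<in>F. e r m \<odot> x r))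
      = (\<Oplus>r\<in>F. c m \<odot> (e r m \<odot> x r) \<oplus> (\<Sum>m\<in>M. e r m * c m) \<odot> x r)"
    unfolding insert.IH using assms by (intro finsum_addf[symmetric]) auto
  also have "\<dots> = (\<Oplus>r\<in>F. (\<Sum>m\<in>insert m M. e r m * c m) \<odot> x r)"
  proof (rule finsum_cong')
    fix r assume "r \<in> F"
    then have "x r \<in> carrier A" using assms by auto
    then show "c m \<odot> (e r m \<odot> x r) \<oplus> (\<Sum>m\<in>M. e r m * c m) \<odot> x r
        = (\<Sum>m\<in>insert m M. e r m * c m) \<odot> x r"
      using insert by (simp add: smult_smult smult_add_left mult.commute)
  qed (use assms in auto)
  finally show ?case .
qed

text \<open>A change of basis followed by the inverse change of basis.\<close>
lemma lincomb_inverse_matrix: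
  assumes "finite F" "x \<in> F \<rightarrow> carrier A" "j \<in> F"
    and "\<And>r. r \<in> F \<Longrightarrow> (\<Sum>m\<in>F. e r m * c m) = (if r = j then 1 else 0)"
  shows "(\<Oplus>m\<in>F. c m \<odot> (\<Oplus>r\<in>F. e r m \<odot> x r)) = x j"
proof -
  have "(\<Oplus>m\<in>F. c m \<odot> (\<Oplus>r\<in>F. e r m \<odot> x r)) = (\<Oplus>r\<in>F. (\<Sum>m\<in>F. e r m * c m) \<odot> x r)"
    using assms by (intro lincomb_lincomb) auto
  also have "\<dots> = (\<Oplus>r\<in>F. if j = r then x r else \<zero>)"
  proof (rule finsum_cong')
    fix r assume "r \<in> F"
    then have "x r \<in> carrier A" using assms by auto
    then show "(\<Sum>m\<in>F. e r m * c m) \<odot> x r = (if j = r then x r else \<zero>)"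
      using assms(4)[OF \<open>r \<in> F\<close>] by simp
  qed (use assms in auto)
  also have "\<dots> = x j"
    using assms by (intro add.finprod_singleton) auto
  finally show ?thesis .
qed

end

text \<open>
  Elements that satisfy the Heisenberg relations with \<open>\<gamma>\<close> specialised to a scalar. The
  structure constants are kept as \<open>w k\<close> times the matrix \<open>\<alpha> k\<close>; in the application \<open>w k\<close> is
  \<open>[kl]\<^sub>q\<close> and \<open>\<alpha> k\<close> is the quantum Cartan matrix.
\<close>
definition heisenberg_family ::
  "('k::field, 'b, 'm) module_scheme \<Rightarrow> nat set \<Rightarrow> (int \<Rightarrow> nat \<Rightarrow> nat \<Rightarrow> 'k) \<Rightarrow>
     (int \<Rightarrow> 'k) \<Rightarrow> (nat \<Rightarrow> int \<Rightarrow> 'b) \<Rightarrow> bool" where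
  "heisenberg_family B I \<alpha> w h \<longleftrightarrow>
     (\<forall>i\<in>I. \<forall>k. k \<noteq> 0 \<longrightarrow> h i k \<in> carrier B) \<and>
     (\<forall>i\<in>I. \<forall>j\<in>I. \<forall>k m. k \<noteq> 0 \<longrightarrow> m \<noteq> 0 \<longrightarrow>
        commutator B (h i k) (h j m) = (if k + m = 0 then w k * \<alpha> k i j else 0) \<odot>\<^bsub>B\<^esub> \<one>\<^bsub>B\<^esub>)"

definition weyl_family ::
  "('k::field, 'b, 'm) module_scheme \<Rightarrow> nat set \<Rightarrow> (nat \<Rightarrow> int \<Rightarrow> 'b) \<Rightarrow> (nat \<Rightarrow> int \<Rightarrow> 'b) \<Rightarrow> bool" where
  "weyl_family B I x p \<longleftrightarrow>
     (\<forall>i\<in>I. \<forall>k>0. x i k \<in> carrier B \<and> p i k \<in> carrier B) \<and>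
     (\<forall>i\<in>I. \<forall>j\<in>I. \<forall>k>0. \<forall>m>0.
        commutator B (x i k) (x j m) = \<zero>\<^bsub>B\<^esub> \<and>
        commutator B (p i k) (p j m) = \<zero>\<^bsub>B\<^esub> \<and>
        commutator B (p i k) (x j m) = (if (i, k) = (j, m) then 1 else 0) \<odot>\<^bsub>B\<^esub> \<one>\<^bsub>B\<^esub>)"

context assoc_algebra
begin

text \<open>
  A positive and a negative generator pair to \<open>w k * \<alpha> k i j\<close> by construction. The same
  pairing read in the opposite order has to be \<open>w (- k) * \<alpha> (- k) j i\<close>, which is why \<open>w\<close> is odd
  and \<open>\<alpha> (- k)\<close> is the transpose of \<open>\<alpha> k\<close>.
\<close>
lemma heisenberg_family_of_weyl_family:
  assumes W: "weyl_family A I x p" and I: "finite I"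
    and w: "\<And>k. w (- k) = - w k"
    and \<alpha>: "\<And>k i j. i \<in> I \<Longrightarrow> j \<in> I \<Longrightarrow> \<alpha> (- k) i j = \<alpha> k j i"
  shows "heisenberg_family A I \<alpha> w
    (\<lambda>i k. if k > 0 then w k \<odot> p i k else (\<Oplus>m\<in>I. \<alpha> (- k) m i \<odot> x m (- k)))"
    (is "heisenberg_family A I \<alpha> w ?h")
proof -
  have cl: "x i k \<in> carrier A" "p i k \<in> carrier A" if "i \<in> I" "k > 0" for i k
    using W that by (auto simp: weyl_family_def)
  have cx: "(\<lambda>m. x m k) \<in> I \<rightarrow> carrier A" if "k > 0" for k
    using cl that by auto
  have rel: "commutator A (x i k) (x j m) = 0 \<odot> \<one>" "commutator A (p i k) (p j m) = \<zero>"
      "commutator A (p i k) (x j m) = (if (i, k) = (j, m) then 1 else 0) \<odot> \<one>"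
    if "i \<in> I" "j \<in> I" "k > 0" "m > 0" for i j k m
    using W that by (auto simp: weyl_family_def)
  have hcl: "?h i k \<in> carrier A" if "i \<in> I" "k \<noteq> 0" for i k
  proof (cases "k > 0")
    case False
    then have "- k > 0" using that by simp
    then show ?thesis using False cx[of "- k"] by simp
  qed (use cl that in simp)
  have pos_neg: "commutator A (?h i k) (?h j m) = (if k + m = 0 then w k * \<alpha> k i j else 0) \<odot> \<one>"
    if ij: "i \<in> I" "j \<in> I" and km: "k > 0" "m < 0" for i j k m
  proof -
    have m: "- m > 0" using km by simp
    have "commutator A (p i k) (\<Oplus>r\<in>I. \<alpha> (- m) r j \<odot> x r (- m))
        = (\<Sum>r\<in>I. \<alpha> (- m) r j * (if (i, k) = (r, - m) then 1 else 0)) \<odot> \<one>"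
      by (rule commutator_lincomb_right) (use I cl cx m rel ij km in auto)
    also have "(\<Sum>r\<in>I. \<alpha> (- m) r j * (if (i, k) = (r, - m) then 1 else 0))
        = (if k + m = 0 then \<alpha> k i j else 0)"
    proof (cases "k + m = 0")
      case True
      then have "m = - k" by simp
      then show ?thesis using I ij by (simp add: if_distrib[of "\<lambda>t. _ * t"] cong: if_cong)
    qed auto
    finally show ?thesis
      using km ij cl(2)[of i k] cx[OF m]
      by (auto simp: commutator_smult_left smult_smult)
  qed
  have "commutator A (?h i k) (?h j m) = (if k + m = 0 then w k * \<alpha> k i j else 0) \<odot> \<one>"
    if ij: "i \<in> I" "j \<in> I" and km: "k \<noteq> 0" "m \<noteq> 0" for i j k m
  proof -
    consider "k > 0" "m > 0" | "k > 0" "m < 0" | "k < 0" "m > 0" | "k < 0" "m < 0"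
      using km by linarith
    then show ?thesis
    proof cases
      case 1
      then show ?thesis
        using ij cl rel(2)[of i j k m] by (simp add: commutator_smult_left commutator_smult_right)
    next
      case 2
      then show ?thesis by (rule pos_neg[OF ij])
    next
      case 3
      have "commutator A (?h i k) (?h j m) = (- (if m + k = 0 then w m * \<alpha> m j i else 0)) \<odot> \<one>"
        using pos_neg[OF ij(2,1) 3(2,1)] hcl ij km by (intro commutator_swap_scalar) auto
      also have "- (if m + k = 0 then w m * \<alpha> m j i else 0) = (if k + m = 0 then w k * \<alpha> k i j else 0)"
      proof (cases "k + m = 0")
        case True
        then have "k = - m" by simp
        then show ?thesis using ij by (simp add: w \<alpha>)
      qed (simp add: add.commute)
      finally show ?thesis .
    next
      case 4
      then have neg: "- k > 0" "- m > 0" by auto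
      have inner: "commutator A (x r (- k)) (\<Oplus>s\<in>I. \<alpha> (- m) s j \<odot> x s (- m)) = 0 \<odot> \<one>"
        if "r \<in> I" for r
      proof -
        have "commutator A (x r (- k)) (\<Oplus>s\<in>I. \<alpha> (- m) s j \<odot> x s (- m))
            = (\<Sum>s\<in>I. \<alpha> (- m) s j * 0) \<odot> \<one>"
          by (rule commutator_lincomb_right) (use I cl cx neg rel that in auto)
        then show ?thesis by simp
      qed
      have "commutator A (\<Oplus>r\<in>I. \<alpha> (- k) r i \<odot> x r (- k)) (\<Oplus>s\<in>I. \<alpha> (- m) s j \<odot> x s (- m))
          = (\<Sum>r\<in>I. \<alpha> (- k) r i * 0) \<odot> \<one>"
        by (rule commutator_lincomb_left) (use I cx neg inner in auto)
      then show ?thesis using 4 by simp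
    qed
  qed
  then show ?thesis
    unfolding heisenberg_family_def using hcl by blast
qed

text \<open>
  The derivations are multiples of positive generators and the variables combinations of negative
  ones. Their commutators are the entries of \<open>\<alpha> k\<close> times its inverse, and \<open>w k\<close> cancels.
\<close>
lemma weyl_family_of_heisenberg_family:
  assumes H: "heisenberg_family A I \<alpha> w h" and I: "finite I"
    and w: "\<And>k. k > 0 \<Longrightarrow> w k \<noteq> 0"
    and \<beta>: "\<And>k. k > 0 \<Longrightarrow> is_inverse_matrix I (\<alpha> k) (\<beta> k)"
  shows "weyl_family A I (\<lambda>j k. \<Oplus>m\<in>I. \<beta> k m j \<odot> h m (- k)) (\<lambda>i k. inverse (w k) \<odot> h i k)"
    (is "weyl_family A I ?x ?p")
proof -
  have cl: "h i k \<in> carrier A" if "i \<in> I" "k \<noteq> 0" for i k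
    using H that by (auto simp: heisenberg_family_def)
  have ch: "(\<lambda>m. h m (- k)) \<in> I \<rightarrow> carrier A" if "k > 0" for k
    using cl that by auto
  have rel: "commutator A (h i k) (h j m) = (if k + m = 0 then w k * \<alpha> k i j else 0) \<odot> \<one>"
    if "i \<in> I" "j \<in> I" "k \<noteq> 0" "m \<noteq> 0" for i j k m
    using H that by (auto simp: heisenberg_family_def)
  have xx: "commutator A (?x i k) (?x j m) = \<zero>"
    if ij: "i \<in> I" "j \<in> I" and km: "k > 0" "m > 0" for i j k m
  proof -
    have inner: "commutator A (h r (- k)) (?x j m) = 0 \<odot> \<one>" if "r \<in> I" for r
    proof -
      have "commutator A (h r (- k)) (?x j m) = (\<Sum>s\<in>I. \<beta> m s j * 0) \<odot> \<one>"
        by (rule commutator_lincomb_right) (use I cl ch km rel that in auto)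
      then show ?thesis by simp
    qed
    have "commutator A (?x i k) (?x j m) = (\<Sum>r\<in>I. \<beta> k r i * 0) \<odot> \<one>"
      by (rule commutator_lincomb_left) (use I ch km inner in auto)
    then show ?thesis by simp
  qed
  have pp: "commutator A (?p i k) (?p j m) = \<zero>"
    if "i \<in> I" "j \<in> I" "k > 0" "m > 0" for i j k m
    using that cl rel[of i j k m] by (simp add: commutator_smult_left commutator_smult_right)
  have px: "commutator A (?p i k) (?x j m) = (if (i, k) = (j, m) then 1 else 0) \<odot> \<one>"
    if ij: "i \<in> I" "j \<in> I" and km: "k > 0" "m > 0" for i j k m
  proof -
    have "commutator A (h i k) (?x j m)
        = (\<Sum>r\<in>I. \<beta> m r j * (if k = m then w k * \<alpha> k i r else 0)) \<odot> \<one>"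
      by (rule commutator_lincomb_right) (use I cl ch km rel ij in auto)
    also have "(\<Sum>r\<in>I. \<beta> m r j * (if k = m then w k * \<alpha> k i r else 0))
        = w k * (if (i, k) = (j, m) then 1 else 0)"
    proof (cases "k = m")
      case True
      have "(\<Sum>r\<in>I. \<alpha> k i r * \<beta> k r j) = (if i = j then 1 else 0)"
        using \<beta>[OF km(1)] ij by (simp add: is_inverse_matrix_def)
      moreover have "(\<Sum>r\<in>I. \<beta> m r j * (w k * \<alpha> k i r)) = w k * (\<Sum>r\<in>I. \<alpha> k i r * \<beta> k r j)"
        using True by (simp add: sum_distrib_left mult_ac)
      ultimately show ?thesis using True by simp
    qed auto
    finally show ?thesis
      using km ij cl[of i k] ch w[of k] w[of m] by (simp add: commutator_smult_left smult_smult)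
  qed
  show ?thesis
    unfolding weyl_family_def using cl ch xx pp px by auto
qed

end

section \<open>Invertibility of the quantum Cartan matrix\<close>

definition fract_of_poly :: "complex poly \<Rightarrow> qfield" where
  "fract_of_poly p = Fract p 1"

interpretation fract_of_poly: comm_ring_hom fract_of_poly
  by unfold_locales (simp_all add: fract_of_poly_def Zero_fract_def One_fract_def)

lemma fract_of_poly_eq_iff: "fract_of_poly p = fract_of_poly r \<longleftrightarrow> p = r"
  by (simp add: fract_of_poly_def eq_fract)

lemma q_half_power: "q_half ^ m = fract_of_poly (monom 1 m)"
proof -
  have "q_half = fract_of_poly (monom 1 1)"
    by (simp add: q_half_def fract_of_poly_def monom_altdef)
  then have "q_half ^ m = fract_of_poly (monom 1 1 ^ m)"
    by (simp only: fract_of_poly.hom_power)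
  then show ?thesis by (simp add: monom_power)
qed

lemma q_half_nonzero [simp]: "q_half \<noteq> 0"
  using q_half_power[of 1] fract_of_poly_eq_iff[of "monom 1 1" 0] by simp

lemma q_nonzero [simp]: "q \<noteq> 0"
  by (simp add: q_def)

lemma q_powi: "q powi m = q_half powi (2 * m)"
  by (simp add: q_def power_int_mult)

text \<open>\<open>q\<^sup>1\<^sup>/\<^sup>2\<close> is an indeterminate, hence not a root of unity.\<close>
lemma q_half_powi_eq_1_iff: "q_half powi m = 1 \<longleftrightarrow> m = 0"
proof -
  have *: "q_half ^ k = 1 \<longleftrightarrow> k = 0" for k
  proof -
    have "q_half ^ k = 1 \<longleftrightarrow> monom 1 k = (1 :: complex poly)"
      using fract_of_poly_eq_iff[of "monom 1 k" 1] by (simp add: q_half_power)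
    also have "\<dots> \<longleftrightarrow> k = 0"
      by (metis degree_1 degree_monom_eq monom_eq_1 zero_neq_one)
    finally show ?thesis .
  qed
  show ?thesis
    using *[of "nat m"] *[of "nat (- m)"]
    by (auto simp: power_int_def field_simps)
qed

lemma q_powi_diff_nonzero:
  assumes "m \<noteq> 0"
  shows "q powi m - q powi (- m) \<noteq> 0"
proof
  assume "q powi m - q powi (- m) = 0"
  then have eq: "q powi m = q powi (- m)" by (simp only: right_minus_eq)
  have "q powi (m + m) = q powi m * q powi m" by (rule power_int_add) simp
  also have "\<dots> = q powi m * q powi (- m)" using eq by (rule arg_cong)
  also have "\<dots> = q powi (m + - m)" by (rule power_int_add[symmetric]) simp
  finally have "q_half powi (2 * (m + m)) = 1" by (simp add: q_powi)
  then show False using assms q_half_powi_eq_1_iff by simp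
qed

lemma qnum_q_nonzero:
  assumes "m \<noteq> 0" shows "qnum q m \<noteq> 0"
  using q_powi_diff_nonzero[OF assms] q_powi_diff_nonzero[of 1]
  by (simp add: qnum_def power_int_minus)

lemma qnum_minus: "qnum v (- m) = - qnum v m"
  by (simp add: qnum_def minus_divide_left)

lemma is_inverse_matrix_scale:
  assumes "is_inverse_matrix I M B" "\<And>i. i \<in> I \<Longrightarrow> r i \<noteq> 0" "\<And>i. i \<in> I \<Longrightarrow> s i \<noteq> 0"
  shows "is_inverse_matrix I (\<lambda>i j. r i * M i j * s j) (\<lambda>i j. inverse (s i) * B i j * inverse (r j))"
proof -
  have "(\<Sum>m\<in>I. r i * M i m * s m * (inverse (s m) * B m j * inverse (r j))) = (if i = j then 1 else 0)"
    if "i \<in> I" "j \<in> I" for i j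
  proof -
    have "(\<Sum>m\<in>I. r i * M i m * s m * (inverse (s m) * B m j * inverse (r j)))
        = r i * inverse (r j) * (\<Sum>m\<in>I. M i m * B m j)"
      unfolding sum_distrib_left by (rule sum.cong) (use assms in \<open>auto simp: field_simps\<close>)
    then show ?thesis using assms that by (simp add: is_inverse_matrix_def)
  qed
  moreover have "(\<Sum>m\<in>I. inverse (s i) * B i m * inverse (r m) * (r m * M m j * s j)) = (if i = j then 1 else 0)"
    if "i \<in> I" "j \<in> I" for i j
  proof -
    have "(\<Sum>m\<in>I. inverse (s i) * B i m * inverse (r m) * (r m * M m j * s j))
        = inverse (s i) * s j * (\<Sum>m\<in>I. B i m * M m j)"
      unfolding sum_distrib_left by (rule sum.cong) (use assms in \<open>auto simp: field_simps\<close>)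
    then show ?thesis using assms that by (simp add: is_inverse_matrix_def)
  qed
  ultimately show ?thesis by (simp add: is_inverse_matrix_def)
qed

text \<open>
  Matrices indexed by \<open>{1..n}\<close> are translated to the type of matrices, whose indices start at \<open>0\<close>.
\<close>
lemma is_inverse_matrix_of_det:
  fixes M :: "nat \<Rightarrow> nat \<Rightarrow> 'k::field"
  assumes det: "det (mat n n (\<lambda>(i, j). M (Suc i) (Suc j))) \<noteq> 0"
  shows "\<exists>B. is_inverse_matrix {1..n} M B"
proof -
  let ?A = "mat n n (\<lambda>(i, j). M (Suc i) (Suc j))"
  have "?A \<in> Units (ring_mat TYPE('k) n ())"
    by (rule det_non_zero_imp_unit[OF _ det]) simp
  then obtain B where B: "B \<in> carrier_mat n n" and BA: "B * ?A = 1\<^sub>m n" and AB: "?A * B = 1\<^sub>m n"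
    by (auto simp: Units_def ring_mat_def)
  let ?B = "\<lambda>i j. B $$ (i - 1, j - 1)"
  have shift: "(\<Sum>m\<in>{1..n}. f m) = (\<Sum>m\<in>{0..<n}. f (Suc m))" for f :: "nat \<Rightarrow> 'k"
    by (simp add: sum.atLeast1_atMost_eq lessThan_atLeast0)
  have "(\<Sum>m\<in>{1..n}. M i m * ?B m j) = (if i = j then 1 else 0)"
    if "i \<in> {1..n}" "j \<in> {1..n}" for i j
  proof -
    have "(?A * B) $$ (i - 1, j - 1) = (if i = j then 1 else 0)"
      unfolding AB using that by auto
    moreover have "(?A * B) $$ (i - 1, j - 1) = (\<Sum>m\<in>{0..<n}. M i (Suc m) * ?B (Suc m) j)"
      using that B by (auto simp: scalar_prod_def intro!: sum.cong)
    ultimately show ?thesis unfolding shift by simp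
  qed
  moreover have "(\<Sum>m\<in>{1..n}. ?B i m * M m j) = (if i = j then 1 else 0)"
    if "i \<in> {1..n}" "j \<in> {1..n}" for i j
  proof -
    have "(B * ?A) $$ (i - 1, j - 1) = (if i = j then 1 else 0)"
      unfolding BA using that by auto
    moreover have "(B * ?A) $$ (i - 1, j - 1) = (\<Sum>m\<in>{0..<n}. ?B i (Suc m) * M (Suc m) j)"
      using that B by (auto simp: scalar_prod_def intro!: sum.cong)
    ultimately show ?thesis unfolding shift by simp
  qed
  ultimately have "is_inverse_matrix {1..n} M ?B"
    unfolding is_inverse_matrix_def by blast
  then show ?thesis by blast
qed

lemma det_nonzero_of_trivial_kernel:
  fixes M :: "nat \<Rightarrow> nat \<Rightarrow> 'k::field"
  assumes "\<And>x. (\<forall>i\<in>{1..n}. (\<Sum>j\<in>{1..n}. M i j * x j) = 0) \<Longrightarrow> \<forall>i\<in>{1..n}. x i = 0"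
  shows "det (mat n n (\<lambda>(i, j). M (Suc i) (Suc j))) \<noteq> 0"
proof
  let ?A = "mat n n (\<lambda>(i, j). M (Suc i) (Suc j))"
  assume "det ?A = 0"
  then obtain v where v: "v \<in> carrier_vec n" "v \<noteq> 0\<^sub>v n" "?A *\<^sub>v v = 0\<^sub>v n"
    using det_0_iff_vec_prod_zero_field[of ?A n] by auto
  have "(\<Sum>j\<in>{1..n}. M i j * v $ (j - 1)) = 0" if "i \<in> {1..n}" for i
  proof -
    have "(?A *\<^sub>v v) $ (i - 1) = 0" unfolding v(3) using that by (intro index_zero_vec) auto
    moreover have "(?A *\<^sub>v v) $ (i - 1) = (\<Sum>m\<in>{0..<n}. M i (Suc m) * v $ m)"
      using that v(1) by (auto simp: scalar_prod_def intro!: sum.cong)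
    ultimately show ?thesis by (simp add: sum.atLeast1_atMost_eq lessThan_atLeast0)
  qed
  then have *: "\<forall>i\<in>{1..n}. v $ (i - 1) = 0"
    using assms[of "\<lambda>j. v $ (j - 1)"] by blast
  have "v $ i = 0" if "i < n" for i
    using *[rule_format, of "Suc i"] that by simp
  then have "v = 0\<^sub>v n" using v(1) by (intro eq_vecI) auto
  then show False using v(2) by simp
qed

text \<open>
  With \<open>s = q\<^sup>1\<^sup>/\<^sup>2\<close>, the polynomial \<open>s\<^sup>N\<^sup>+\<^sup>m - s\<^sup>N\<^sup>-\<^sup>m\<close> vanishes at \<open>1\<close>, so it is divisible by
  \<open>s - 1\<close>, and the quotient takes at \<open>1\<close> the value of the derivative, \<open>(N + m) - (N - m)\<close>. The
  factor \<open>s\<^sup>N\<close> that clears the negative powers can be the same for all entries of a matrix.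
\<close>
lemma q_half_powi_diff_factor:
  assumes "\<bar>m\<bar> \<le> int N"
  shows "\<exists>p. q_half powi m - q_half powi (- m) = fract_of_poly [:-1, 1:] * inverse (q_half ^ N) * fract_of_poly p
           \<and> poly p 1 = 2 * of_int m"
proof -
  define a b where "a = nat (int N + m)" and "b = nat (int N - m)"
  let ?c = "monom 1 a - monom 1 b :: complex poly"
  have "poly ?c 1 = 0" by (simp add: poly_monom)
  then obtain p where p: "?c = [:-1, 1:] * p"
    by (metis dvdE poly_eq_0_iff_dvd)
  have "poly (pderiv ?c) 1 = of_nat a - of_nat b"
    by (simp add: pderiv_monom pderiv_diff poly_monom)
  moreover have "poly (pderiv ([:-1, 1:] * p)) 1 = poly p 1"
    by (subst pderiv_mult) (simp add: pderiv_pCons)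
  moreover have "(of_nat a - of_nat b :: complex) = of_int (int a - int b)" by simp
  moreover have "int a - int b = 2 * m" using assms unfolding a_def b_def by linarith
  ultimately have eval: "poly p 1 = 2 * of_int m" using p by simp
  have shift: "q_half powi m = inverse (q_half ^ N) * q_half ^ nat (int N + m)" if "\<bar>m\<bar> \<le> int N" for m
  proof -
    have "q_half ^ nat (int N + m) = q_half powi (int N + m)" using that by (simp add: power_int_def)
    then show ?thesis by (simp add: power_int_add)
  qed
  have "q_half powi m - q_half powi (- m) = inverse (q_half ^ N) * (q_half ^ a - q_half ^ b)"
    using shift[of m] shift[of "- m"] assms by (simp add: a_def b_def algebra_simps)
  also have "q_half ^ a - q_half ^ b = fract_of_poly ([:-1, 1:] * p)"
    unfolding p[symmetric] by (simp add: q_half_power fract_of_poly.hom_minus)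
  also have "fract_of_poly ([:-1, 1:] * p) = fract_of_poly [:-1, 1:] * fract_of_poly p"
    by (rule fract_of_poly.hom_mult)
  finally show ?thesis using eval by (intro exI[of _ p]) (simp only: mult_ac simp_thms)
qed

text \<open>
  Specialisation at \<open>q\<^sup>1\<^sup>/\<^sup>2 = 1\<close>: after the common factor has been removed, the entries are polynomials
  and evaluation at \<open>1\<close> is a ring homomorphism, so it commutes with the determinant. The evaluated
  matrix is \<open>2 c\<close>, which has trivial kernel; hence the determinant is not the zero polynomial.
\<close>
lemma quantum_matrix_invertible:
  fixes c :: "nat \<Rightarrow> nat \<Rightarrow> int"
  assumes ker: "\<And>x :: nat \<Rightarrow> complex.
      (\<forall>i\<in>{1..n}. (\<Sum>j\<in>{1..n}. of_int (c i j) * x j) = 0) \<Longrightarrow> \<forall>i\<in>{1..n}. x i = 0"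
  shows "\<exists>B. is_inverse_matrix {1..n} (\<lambda>i j. q_half powi c i j - q_half powi (- c i j)) B"
proof -
  \<comment> \<open>any common bound for the exponents will do\<close>
  define N where "N = (\<Sum>i\<in>{1..n}. \<Sum>j\<in>{1..n}. nat \<bar>c i j\<bar>)"
  have N: "\<bar>c i j\<bar> \<le> int N" if "i \<in> {1..n}" "j \<in> {1..n}" for i j
  proof -
    have "nat \<bar>c i j\<bar> \<le> (\<Sum>j\<in>{1..n}. nat \<bar>c i j\<bar>)"
      using that by (intro member_le_sum) auto
    also have "\<dots> \<le> N"
      unfolding N_def using that
      by (intro member_le_sum[of i "{1..n}" "\<lambda>i. \<Sum>j\<in>{1..n}. nat \<bar>c i j\<bar>"]) auto
    finally show ?thesis by linarith
  qed
  let ?u = "fract_of_poly [:-1, 1:] * inverse (q_half ^ N)"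
  have "\<exists>p. i \<in> {1..n} \<longrightarrow> j \<in> {1..n} \<longrightarrow>
      q_half powi c i j - q_half powi (- c i j) = ?u * fract_of_poly p \<and> poly p 1 = 2 * of_int (c i j)" for i j
    using q_half_powi_diff_factor[OF N[of i j]] by blast
  then obtain P where P: "\<And>i j. i \<in> {1..n} \<Longrightarrow> j \<in> {1..n} \<Longrightarrow>
      q_half powi c i j - q_half powi (- c i j) = ?u * fract_of_poly (P i j)"
      "\<And>i j. i \<in> {1..n} \<Longrightarrow> j \<in> {1..n} \<Longrightarrow> poly (P i j) 1 = 2 * of_int (c i j)"
    by metis
  let ?P = "mat n n (\<lambda>(i, j). P (Suc i) (Suc j))"
  interpret eval: comm_ring_hom "\<lambda>p :: complex poly. poly p 1"
    by unfold_locales auto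
  have "det (mat n n (\<lambda>(i, j). 2 * of_int (c (Suc i) (Suc j)) :: complex)) \<noteq> 0"
  proof (rule det_nonzero_of_trivial_kernel[of n "\<lambda>i j. 2 * of_int (c i j)"])
    fix x :: "nat \<Rightarrow> complex"
    assume "\<forall>i\<in>{1..n}. (\<Sum>j\<in>{1..n}. 2 * of_int (c i j) * x j) = 0"
    then have "\<forall>i\<in>{1..n}. (\<Sum>j\<in>{1..n}. of_int (c i j) * x j) = 0"
      by (simp add: mult.assoc flip: sum_distrib_left)
    then show "\<forall>i\<in>{1..n}. x i = 0" by (rule ker)
  qed
  also have "mat n n (\<lambda>(i, j). 2 * of_int (c (Suc i) (Suc j)) :: complex) = map_mat (\<lambda>p. poly p 1) ?P"
    using P(2) by (intro eq_matI) auto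
  finally have "det ?P \<noteq> 0" by auto
  then have "fract_of_poly (det ?P) \<noteq> 0"
    using fract_of_poly_eq_iff[of _ 0] by simp
  also have "fract_of_poly (det ?P) = det (mat n n (\<lambda>(i, j). fract_of_poly (P (Suc i) (Suc j))))"
    unfolding fract_of_poly.hom_det[symmetric] by (intro arg_cong[of _ _ det] eq_matI) auto
  finally obtain B where "is_inverse_matrix {1..n} (\<lambda>i j. fract_of_poly (P i j)) B"
    using is_inverse_matrix_of_det[of n "\<lambda>i j. fract_of_poly (P i j)"] by auto
  moreover have "?u \<noteq> 0"
    using fract_of_poly_eq_iff[of "[:-1, 1:]" 0] by simp
  ultimately have "is_inverse_matrix {1..n} (\<lambda>i j. ?u * fract_of_poly (P i j) * 1)
      (\<lambda>i j. inverse 1 * B i j * inverse ?u)"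
    by (intro is_inverse_matrix_scale) auto
  then have "is_inverse_matrix {1..n} (\<lambda>i j. q_half powi c i j - q_half powi (- c i j))
      (\<lambda>i j. inverse 1 * B i j * inverse ?u)"
    by (simp add: is_inverse_matrix_def P(1))
  then show ?thesis by blast
qed

text \<open>
  The symmetrised form is positive definite on real vectors, so a real kernel vector vanishes;
  the real and imaginary parts of a complex kernel vector are kernel vectors.
\<close>
lemma finite_type_trivial_kernel:
  fixes x :: "nat \<Rightarrow> complex"
  assumes D: "finite_type_symmetrizer S a D" and S: "finite S"
    and x: "\<forall>i\<in>S. (\<Sum>j\<in>S. of_int (a i j) * x j) = 0"
  shows "\<forall>i\<in>S. x i = 0"
proof -
  have real: "\<forall>i\<in>S. y i = 0" if y: "\<forall>i\<in>S. (\<Sum>j\<in>S. real_of_int (a i j) * y j) = 0" for y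
  proof -
    have "cartan_form S a D y y = (\<Sum>i\<in>S. D i * y i * (\<Sum>j\<in>S. of_int (a i j) * y j))"
      by (simp add: cartan_form_def sum_distrib_left mult_ac)
    also have "\<dots> = 0" using y by simp
    finally show ?thesis using D unfolding finite_type_symmetrizer_def by force
  qed
  have "(\<Sum>j\<in>S. of_int (a i j) * Re (x j)) = 0 \<and> (\<Sum>j\<in>S. of_int (a i j) * Im (x j)) = 0" if "i \<in> S" for i
    using x[rule_format, OF that] by (simp add: complex_eq_iff)
  then show ?thesis
    using real[of "\<lambda>j. Re (x j)"] real[of "\<lambda>j. Im (x j)"] by (simp add: complex_eq_iff)
qed

text \<open>
  The entry is \<open>q\<^sup>m - q\<^sup>-\<^sup>m\<close> with \<open>m = k d\<^sub>i a\<^sub>i\<^sub>j\<close>, multiplied by a factor that depends only on the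
  row and one that depends only on the column.
\<close>
lemma qa_eq:
  shows "qa a d k i j =
     inverse (q powi int (d i) - q powi (- int (d i))) *
     (q_half powi (2 * k * (int (d i) * a i j)) - q_half powi (- (2 * k * (int (d i) * a i j)))) *
     ((q - inverse q) / (of_int k * (q powi int (d j) - q powi (- int (d j)))))"
proof -
  have pow: "(q ^ d i) powi m = q_half powi (2 * (int (d i) * m))" for i m
    by (simp only: power_int_mult q_def power_int_of_nat power_int_numeral)
  have "qnum (q ^ d i) (k * a i j)
      = (q_half powi (2 * k * (int (d i) * a i j)) - q_half powi (- (2 * k * (int (d i) * a i j))))
        / (q powi int (d i) - q powi (- int (d i)))"
  proof -
    have "(q ^ d i) powi (k * a i j) = q_half powi (2 * k * (int (d i) * a i j))"
      unfolding pow by (simp only: mult_ac)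
    moreover have "(q ^ d i) powi (- (k * a i j)) = q_half powi (- (2 * k * (int (d i) * a i j)))"
      unfolding pow mult_minus_right by (simp only: mult_ac)
    moreover have "inverse (q ^ d i) = q powi (- int (d i))" "q ^ d i = q powi int (d i)"
      by (simp_all add: power_int_minus)
    ultimately show ?thesis unfolding qnum_def by (simp only:)
  qed
  moreover have "(x / y) / (z * (v / w)) = inverse y * x * (w / (z * v))" for x y z v w :: qfield
    by (simp add: divide_inverse mult_ac)
  ultimately show ?thesis
    unfolding qa_def qnum_def[of q] by (simp only:)
qed

text \<open>
  By the product form of the entries: the exponent \<open>k d\<^sub>i a\<^sub>i\<^sub>j\<close> is symmetric in \<open>i\<close> and \<open>j\<close>, and the
  signs of \<open>q\<^sup>m - q\<^sup>-\<^sup>m\<close> and of \<open>1 / k\<close> cancel.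
\<close>
lemma qa_minus_transpose:
  assumes "int (d i) * a i j = int (d j) * a j i"
  shows "qa a d (- k) i j = qa a d k j i"
proof -
  let ?e = "2 * k * (int (d i) * a i j)"
  have swap: "inverse x * (y - z) * (u / (- c * w)) = inverse w * (z - y) * (u / (c * x))"
    for x y z u c w :: qfield
    unfolding divide_inverse inverse_mult_distrib inverse_minus_eq by (simp add: algebra_simps)
  have *: "2 * (- k) * (int (d i) * a i j) = - ?e" "- (- ?e) = ?e" by simp_all
  show ?thesis
    unfolding qa_eq[of a d k i j] qa_eq[of a d k j i] qa_eq[of a d "- k" i j] assms[symmetric] *
      of_int_minus
    by (rule swap)
qed

lemma qa_invertible:
  assumes D: "finite_type_symmetrizer {1..n} a D" and d: "\<forall>i\<in>{1..n}. d i > 0" and k: "k \<noteq> 0"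
  shows "is_inverse_matrix {1..n} (qa a d k) (qb n a d k)"
proof -
  let ?c = "\<lambda>i j. 2 * k * (int (d i) * a i j)"
  obtain B where B: "is_inverse_matrix {1..n} (\<lambda>i j. q_half powi ?c i j - q_half powi (- ?c i j)) B"
  proof (rule exE[OF quantum_matrix_invertible[of n ?c]])
    fix x :: "nat \<Rightarrow> complex"
    assume x: "\<forall>i\<in>{1..n}. (\<Sum>j\<in>{1..n}. of_int (?c i j) * x j) = 0"
    have "(\<Sum>j\<in>{1..n}. of_int (a i j) * x j) = 0" if i: "i \<in> {1..n}" for i
    proof -
      have "(\<Sum>j\<in>{1..n}. of_int (?c i j) * x j) = 2 * of_int k * of_nat (d i) * (\<Sum>j\<in>{1..n}. of_int (a i j) * x j)"
        by (simp add: sum_distrib_left mult_ac)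
      moreover have "(\<Sum>j\<in>{1..n}. of_int (?c i j) * x j) = 0" using x i by blast
      moreover have "d i \<noteq> 0" using d i by force
      ultimately show ?thesis using k by simp
    qed
    then show "\<forall>i\<in>{1..n}. x i = 0"
      using finite_type_trivial_kernel[OF D, of x] by blast
  qed
  let ?t = "\<lambda>i. q powi int (d i) - q powi (- int (d i))"
  let ?r = "\<lambda>i. inverse (?t i)" and ?s = "\<lambda>j. (q - inverse q) / (of_int k * ?t j)"
  have t: "?t i \<noteq> 0" if "i \<in> {1..n}" for i
    using q_powi_diff_nonzero[of "int (d i)"] d that by auto
  have q: "q - inverse q \<noteq> 0"
    using q_powi_diff_nonzero[of 1] by (simp add: power_int_minus)
  have k': "(of_int k :: qfield) \<noteq> 0"
  proof -
    have "(of_int k :: qfield) = fract_of_poly (of_int k)"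
      by (rule fract_of_poly.hom_of_int[symmetric])
    then show ?thesis using fract_of_poly_eq_iff[of "of_int k" 0] k by simp
  qed
  have "is_inverse_matrix {1..n} (\<lambda>i j. ?r i * (q_half powi ?c i j - q_half powi (- ?c i j)) * ?s j)
      (\<lambda>i j. inverse (?s i) * B i j * inverse (?r j))"
    by (rule is_inverse_matrix_scale[OF B]) (use t q k' in auto)
  moreover have "qa a d k i j = ?r i * (q_half powi ?c i j - q_half powi (- ?c i j)) * ?s j"
    if "i \<in> {1..n}" "j \<in> {1..n}" for i j
    by (rule qa_eq)
  ultimately have "is_inverse_matrix {1..n} (qa a d k) (\<lambda>i j. inverse (?s i) * B i j * inverse (?r j))"
    by (simp add: is_inverse_matrix_def)
  then show ?thesis unfolding qb_def by (rule someI[of "is_inverse_matrix {1..n} (qa a d k)"])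
qed

section \<open>The quantum Heisenberg algebra at a fixed level\<close>

lemma q_half_powi_power: "(q_half powi m) ^ (2 * j) = q powi (int j * m)"
proof -
  have "(q_half powi m) ^ (2 * j) = (q_half powi m) powi int (2 * j)"
    by (rule power_int_of_nat[symmetric])
  also have "\<dots> = q_half powi (m * int (2 * j))" by (rule power_int_mult[symmetric])
  also have "m * int (2 * j) = 2 * (int j * m)" by simp
  finally show ?thesis by (simp only: q_powi)
qed

lemma heis_free_gen_closed:
  "i \<in> {1..n} \<Longrightarrow> k \<noteq> 0 \<Longrightarrow> free_gen (H i k) \<in> carrier (heis_free n)"
  "free_gen Gamma_Half \<in> carrier (heis_free n)"
  "free_gen Gamma_Neg_Half \<in> carrier (heis_free n)"
  by (auto intro!: free_gen_closed simp: heis_symbols_def)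

lemma heis_gamma_free_closed: "heis_gamma_free n k \<in> carrier (heis_free n)"
proof -
  interpret F: assoc_algebra "heis_free n" by (rule assoc_algebra_free_algebra)
  show ?thesis using heis_free_gen_closed by (simp add: heis_gamma_free_def)
qed

lemma heis_relations_closed: "heis_relations n a d \<subseteq> carrier (heis_free n)"
proof -
  interpret F: assoc_algebra "heis_free n" by (rule assoc_algebra_free_algebra)
  have "free_gen g \<in> carrier (heis_free n)" if "g \<in> heis_symbols n" for g
    using that by (rule free_gen_closed)
  then show ?thesis
    using heis_free_gen_closed heis_gamma_free_closed
    by (auto simp: heis_relations_def)
qed

text \<open>
  The word for \<open>\<gamma>\<^sup>k\<close> uses a different generator for negative \<open>k\<close>; both cases give \<open>q\<^sup>k\<^sup>l\<close>. This is
  needed twice: for the projection to the level \<open>l\<close> quotient, and for the homomorphism that its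
  universal property starts from.
\<close>
lemma hom_heis_gamma_free:
  fixes l :: int
  assumes "algebra_morphism (heis_free n) B \<phi>"
    and "\<phi> (free_gen Gamma_Half) = (q_half powi l) \<odot>\<^bsub>B\<^esub> \<one>\<^bsub>B\<^esub>"
    and "\<phi> (free_gen Gamma_Neg_Half) = (q_half powi (- l)) \<odot>\<^bsub>B\<^esub> \<one>\<^bsub>B\<^esub>"
  shows "\<phi> (heis_gamma_free n k) = (q powi (k * l)) \<odot>\<^bsub>B\<^esub> \<one>\<^bsub>B\<^esub>"
proof -
  interpret \<phi>: algebra_morphism "heis_free n" B \<phi> by fact
  have closed: "free_gen Gamma_Half \<in> carrier (heis_free n)"
      "free_gen Gamma_Neg_Half \<in> carrier (heis_free n)"
    by (rule heis_free_gen_closed)+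
  show ?thesis
  proof (cases "k \<ge> 0")
    case True
    then have "\<phi> (heis_gamma_free n k) = ((q_half powi l) ^ (2 * nat k)) \<odot>\<^bsub>B\<^esub> \<one>\<^bsub>B\<^esub>"
      using closed assms(2)
      by (simp only: heis_gamma_free_def if_True \<phi>.hom_power \<phi>.target.scalar_power)
    then show ?thesis using True by (simp only: q_half_powi_power int_nat_eq if_True)
  next
    case False
    then have "\<phi> (heis_gamma_free n k) = ((q_half powi (- l)) ^ (2 * nat (- k))) \<odot>\<^bsub>B\<^esub> \<one>\<^bsub>B\<^esub>"
      using closed assms(3)
      by (simp only: heis_gamma_free_def if_False \<phi>.hom_power \<phi>.target.scalar_power)
    also have "(q_half powi (- l)) ^ (2 * nat (- k)) = q powi (int (nat (- k)) * - l)" by (rule q_half_powi_power)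
    also have "int (nat (- k)) * - l = k * l" using False by simp
    finally show ?thesis .
  qed
qed

text \<open>
  The level \<open>l\<close> algebra is a quotient of a quotient; this is the composite projection from the free
  algebra.
\<close>
definition level_proj ::
  "nat \<Rightarrow> (nat \<Rightarrow> nat \<Rightarrow> int) \<Rightarrow> (nat \<Rightarrow> nat) \<Rightarrow> int \<Rightarrow>
     (heis_symbol list \<Rightarrow> qfield) \<Rightarrow> (heis_symbol list \<Rightarrow> qfield) set set" where
  "level_proj n a d l = level_class n a d l \<circ> presented_proj (heis_symbols n) (heis_relations n a d)"

lemma heis_algebra:
  "assoc_algebra (heis n a d)"
  "presented_proj (heis_symbols n) (heis_relations n a d) \<in> algebra_hom (heis_free n) (heis n a d)"
  "carrier (heis n a d)
     = presented_proj (heis_symbols n) (heis_relations n a d) ` carrier (heis_free n)"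
  using presented_algebra(1-3)[OF heis_relations_closed[of n a d]] by (simp_all add: heis_def)

lemma heis_gen_eq_proj:
  "heis_gen n a d s = presented_proj (heis_symbols n) (heis_relations n a d) (free_gen s)"
  by (simp add: heis_gen_def presented_gen_def presented_proj_def)

lemma heis_gen_closed: "s \<in> heis_symbols n \<Longrightarrow> heis_gen n a d s \<in> carrier (heis n a d)"
  by (simp add: heis_gen_eq_proj heis_algebra(3) free_gen_closed)

lemma heis_level_algebra:
  "assoc_algebra (heis_level n a d l)"
  "level_class n a d l \<in> algebra_hom (heis n a d) (heis_level n a d l)"
  "level_proj n a d l \<in> algebra_hom (heis_free n) (heis_level n a d l)"
  "carrier (heis_level n a d l) = level_proj n a d l ` carrier (heis_free n)"
  "level_proj n a d l (free_gen Gamma_Half)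
     = (q_half powi l) \<odot>\<^bsub>heis_level n a d l\<^esub> \<one>\<^bsub>heis_level n a d l\<^esub>"
proof -
  interpret G: assoc_algebra "heis n a d" by (rule heis_algebra)
  have g: "heis_gen n a d Gamma_Half \<in> carrier (heis n a d)"
    by (rule heis_gen_closed) (simp add: heis_symbols_def)
  let ?T = "{heis_gen n a d Gamma_Half [^]\<^bsub>heis n a d\<^esub> (2::nat)
          \<ominus>\<^bsub>heis n a d\<^esub> (q powi l) \<odot>\<^bsub>heis n a d\<^esub> \<one>\<^bsub>heis n a d\<^esub>,
        heis_gen n a d Gamma_Half
          \<ominus>\<^bsub>heis n a d\<^esub> (q_half powi l) \<odot>\<^bsub>heis n a d\<^esub> \<one>\<^bsub>heis n a d\<^esub>}"
  have T: "?T \<subseteq> carrier (heis n a d)" using g by simp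
  note Q = G.quot_algebra_Idl[OF T, folded heis_level_ideal_def, folded heis_level_def level_class_def]
  show L: "assoc_algebra (heis_level n a d l)" by (rule Q(1))
  show hom: "level_class n a d l \<in> algebra_hom (heis n a d) (heis_level n a d l)"
    using Q(2) by (simp add: level_class_def[abs_def])
  show "level_proj n a d l \<in> algebra_hom (heis_free n) (heis_level n a d l)"
    unfolding level_proj_def by (rule algebra_hom_comp[OF heis_algebra(2) hom])
  show "carrier (heis_level n a d l) = level_proj n a d l ` carrier (heis_free n)"
    unfolding level_proj_def Q(3) heis_algebra(3) image_image
    by (simp add: level_class_def)
  interpret L: assoc_algebra "heis_level n a d l" by (rule L)
  interpret p: algebra_morphism "heis n a d" "heis_level n a d l" "level_class n a d l"
    by unfold_locales (rule hom)
  let ?g = "heis_gen n a d Gamma_Half" and ?c = "(q_half powi l) \<odot>\<^bsub>heis n a d\<^esub> \<one>\<^bsub>heis n a d\<^esub>"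
  have "level_class n a d l (?g \<ominus>\<^bsub>heis n a d\<^esub> ?c) = \<zero>\<^bsub>heis_level n a d l\<^esub>"
    using Q(4) by blast
  then have "level_class n a d l ?g \<ominus>\<^bsub>heis_level n a d l\<^esub>
      (q_half powi l) \<odot>\<^bsub>heis_level n a d l\<^esub> \<one>\<^bsub>heis_level n a d l\<^esub> = \<zero>\<^bsub>heis_level n a d l\<^esub>"
    using g by simp
  then show "level_proj n a d l (free_gen Gamma_Half)
     = (q_half powi l) \<odot>\<^bsub>heis_level n a d l\<^esub> \<one>\<^bsub>heis_level n a d l\<^esub>"
    using g by (simp add: L.minus_eq_zero_iff level_proj_def flip: heis_gen_eq_proj)
qed

lemma level_proj_relation:
  assumes "r \<in> heis_relations n a d"
  shows "level_proj n a d l r = \<zero>\<^bsub>heis_level n a d l\<^esub>"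
proof -
  interpret p: algebra_morphism "heis n a d" "heis_level n a d l" "level_class n a d l"
    by (intro algebra_morphism.intro algebra_morphism_axioms.intro heis_algebra heis_level_algebra)
  have "presented_proj (heis_symbols n) (heis_relations n a d) r = \<zero>\<^bsub>heis n a d\<^esub>"
    using presented_algebra(4)[OF heis_relations_closed assms] by (simp add: heis_def)
  then show ?thesis by (simp add: level_proj_def)
qed

lemma heisenberg_scalar:
  "(if k + m = 0 then e / (q - inverse q) else 0) * (q powi (k * l) - q powi (- k * l))
     = (if k + m = 0 then qnum q (k * l) * e else 0)"
  by (simp add: qnum_def)

text \<open>The image of \<open>\<gamma>\<^sup>1\<^sup>/\<^sup>2\<close> is a nonzero scalar, and the relations make the image of \<open>\<gamma>\<^sup>-\<^sup>1\<^sup>/\<^sup>2\<close> its inverse.\<close>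
lemma level_proj_Gamma_Neg_Half:
  "level_proj n a d l (free_gen Gamma_Neg_Half)
     = (q_half powi (- l)) \<odot>\<^bsub>heis_level n a d l\<^esub> \<one>\<^bsub>heis_level n a d l\<^esub>"
proof -
  let ?L = "heis_level n a d l" and ?\<pi> = "level_proj n a d l"
  interpret p: algebra_morphism "heis_free n" ?L ?\<pi>
    by (intro algebra_morphism.intro algebra_morphism_axioms.intro assoc_algebra_free_algebra
        heis_level_algebra)
  let ?g = "free_gen Gamma_Half" and ?g' = "free_gen Gamma_Neg_Half"
  have cl: "?g \<in> carrier (heis_free n)" "?g' \<in> carrier (heis_free n)"
    by (rule heis_free_gen_closed)+
  have "?\<pi> (?g \<otimes>\<^bsub>heis_free n\<^esub> ?g' \<ominus>\<^bsub>heis_free n\<^esub> \<one>\<^bsub>heis_free n\<^esub>) = \<zero>\<^bsub>?L\<^esub>"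
    by (rule level_proj_relation) (simp add: heis_relations_def)
  then have "(q_half powi l) \<odot>\<^bsub>?L\<^esub> ?\<pi> ?g' = \<one>\<^bsub>?L\<^esub>"
    using cl by (simp add: heis_level_algebra(5) p.target.smult_mult_left p.target.minus_eq_zero_iff)
  then have "(q_half powi (- l)) \<odot>\<^bsub>?L\<^esub> ((q_half powi l) \<odot>\<^bsub>?L\<^esub> ?\<pi> ?g')
      = (q_half powi (- l)) \<odot>\<^bsub>?L\<^esub> \<one>\<^bsub>?L\<^esub>" by simp
  then show ?thesis
    using cl by (simp add: p.target.smult_smult power_int_minus)
qed

lemma heis_level_heisenberg_family:
  "heisenberg_family (heis_level n a d l) {1..n} (qa a d) (\<lambda>k. qnum q (k * l))
     (\<lambda>i k. level_proj n a d l (free_gen (H i k)))"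
proof -
  let ?L = "heis_level n a d l" and ?\<pi> = "level_proj n a d l"
  interpret p: algebra_morphism "heis_free n" ?L ?\<pi>
    by (intro algebra_morphism.intro algebra_morphism_axioms.intro assoc_algebra_free_algebra
        heis_level_algebra)
  have gamma: "?\<pi> (heis_gamma_free n k) = (q powi (k * l)) \<odot>\<^bsub>?L\<^esub> \<one>\<^bsub>?L\<^esub>" for k
    by (rule hom_heis_gamma_free[OF p.algebra_morphism_axioms heis_level_algebra(5) level_proj_Gamma_Neg_Half])
  have "commutator ?L (?\<pi> (free_gen (H i k))) (?\<pi> (free_gen (H j m)))
      = (if k + m = 0 then qnum q (k * l) * qa a d k i j else 0) \<odot>\<^bsub>?L\<^esub> \<one>\<^bsub>?L\<^esub>"
    if ij: "i \<in> {1..n}" "j \<in> {1..n}" and km: "k \<noteq> 0" "m \<noteq> 0" for i j k m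
  proof -
    let ?e = "if k + m = 0 then qa a d k i j / (q - inverse q) else 0"
    have cl: "free_gen (H i k) \<in> carrier (heis_free n)" "free_gen (H j m) \<in> carrier (heis_free n)"
      using ij km by (auto intro: heis_free_gen_closed)
    have "?\<pi> (commutator (heis_free n) (free_gen (H i k)) (free_gen (H j m)) \<ominus>\<^bsub>heis_free n\<^esub>
       (?e \<odot>\<^bsub>heis_free n\<^esub> (heis_gamma_free n k \<ominus>\<^bsub>heis_free n\<^esub> heis_gamma_free n (- k)))) = \<zero>\<^bsub>?L\<^esub>"
      by (rule level_proj_relation) (use ij km in \<open>unfold heis_relations_def, blast\<close>)
    then have "commutator ?L (?\<pi> (free_gen (H i k))) (?\<pi> (free_gen (H j m)))
        = ?e \<odot>\<^bsub>?L\<^esub> ((q powi (k * l)) \<odot>\<^bsub>?L\<^esub> \<one>\<^bsub>?L\<^esub> \<ominus>\<^bsub>?L\<^esub> (q powi (- k * l)) \<odot>\<^bsub>?L\<^esub> \<one>\<^bsub>?L\<^esub>)"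
      using cl heis_gamma_free_closed[of n]
      by (simp only: p.hom_minus p.hom_smult p.hom_commutator gamma p.target.minus_eq_zero_iff
          p.source.commutator_closed p.source.minus_closed p.source.smult_closed p.hom_closed
          p.target.commutator_closed p.target.minus_closed p.target.smult_closed p.target.one_closed)
    also have "\<dots> = (?e * (q powi (k * l) - q powi (- k * l))) \<odot>\<^bsub>?L\<^esub> \<one>\<^bsub>?L\<^esub>"
      by (simp only: p.target.smult_smult p.target.smult_diff[symmetric] p.target.one_closed)
    finally show ?thesis unfolding heisenberg_scalar .
  qed
  then show ?thesis
    unfolding heisenberg_family_def using heis_free_gen_closed(1) p.hom_closed by blast
qed

text \<open>
  Sending \<open>\<gamma>\<^sup>1\<^sup>/\<^sup>2\<close> and \<open>\<gamma>\<^sup>-\<^sup>1\<^sup>/\<^sup>2\<close> to mutually inverse scalars makes the relations that involve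
  only them, and their centrality, automatic; the remaining relation is the definition of
  a Heisenberg family. The two generators of the level ideal are sent to \<open>0\<close> by the choice of the
  scalar.
\<close>
lemma heis_level_universal:
  assumes B: "assoc_algebra B"
    and h: "heisenberg_family B {1..n} (qa a d) (\<lambda>k. qnum q (k * l)) h"
  shows "\<exists>\<psi> \<in> algebra_hom (heis_level n a d l) B.
    \<forall>i\<in>{1..n}. \<forall>k. k \<noteq> 0 \<longrightarrow> \<psi> (level_proj n a d l (free_gen (H i k))) = h i k"
proof -
  interpret B: assoc_algebra B by (rule B)
  let ?F = "heis_free n" and ?G = "heis n a d"
  let ?\<pi> = "presented_proj (heis_symbols n) (heis_relations n a d)"
  define f where "f s = (case s of H i k \<Rightarrow> h i k
      | Gamma_Half \<Rightarrow> (q_half powi l) \<odot>\<^bsub>B\<^esub> \<one>\<^bsub>B\<^esub>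
      | Gamma_Neg_Half \<Rightarrow> (q_half powi (- l)) \<odot>\<^bsub>B\<^esub> \<one>\<^bsub>B\<^esub>)" for s
  have f: "f \<in> heis_symbols n \<rightarrow> carrier B"
    using h by (auto simp: f_def heis_symbols_def heisenberg_family_def)
  interpret lift: algebra_morphism ?F B "free_lift B f"
    by (intro algebra_morphism.intro algebra_morphism_axioms.intro assoc_algebra_free_algebra B
        B.free_lift_hom[OF f])
  have gen: "free_lift B f (free_gen s) = f s" if "s \<in> heis_symbols n" for s
    by (rule B.free_lift_free_gen[OF f that])
  have sym: "Gamma_Half \<in> heis_symbols n" "Gamma_Neg_Half \<in> heis_symbols n"
      "\<And>i k. i \<in> {1..n} \<Longrightarrow> k \<noteq> 0 \<Longrightarrow> H i k \<in> heis_symbols n"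
    by (auto simp: heis_symbols_def)
  have gamma: "free_lift B f (heis_gamma_free n k) = (q powi (k * l)) \<odot>\<^bsub>B\<^esub> \<one>\<^bsub>B\<^esub>" for k
    by (rule hom_heis_gamma_free[OF lift.algebra_morphism_axioms]) (simp_all add: gen sym f_def)
  note cl = free_gen_closed[of _ "heis_symbols n"]
  have "free_lift B f r = \<zero>\<^bsub>B\<^esub>" if r: "r \<in> heis_relations n a d" for r
  proof -
    consider
        "r = free_gen Gamma_Half \<otimes>\<^bsub>?F\<^esub> free_gen Gamma_Neg_Half \<ominus>\<^bsub>?F\<^esub> \<one>\<^bsub>?F\<^esub>"
      | "r = free_gen Gamma_Neg_Half \<otimes>\<^bsub>?F\<^esub> free_gen Gamma_Half \<ominus>\<^bsub>?F\<^esub> \<one>\<^bsub>?F\<^esub>"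
      | (central) g x where "r = commutator ?F (free_gen g) (free_gen x)"
          "g \<in> {Gamma_Half, Gamma_Neg_Half}" "x \<in> heis_symbols n"
      | (heis) i j k m where "r = commutator ?F (free_gen (H i k)) (free_gen (H j m)) \<ominus>\<^bsub>?F\<^esub>
            ((if k + m = 0 then qa a d k i j / (q - inverse q) else 0) \<odot>\<^bsub>?F\<^esub>
               (heis_gamma_free n k \<ominus>\<^bsub>?F\<^esub> heis_gamma_free n (- k)))"
          "i \<in> {1..n}" "j \<in> {1..n}" "k \<noteq> 0" "m \<noteq> 0"
      using r unfolding heis_relations_def by blast
    then show ?thesis
    proof cases
      case 1
      then show ?thesis
        by (simp add: cl gen sym f_def B.smult_mult_left B.smult_smult power_int_minus
            B.minus_eq_zero_iff)
    next
      case 2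
      then show ?thesis
        by (simp add: cl gen sym f_def B.smult_mult_left B.smult_smult power_int_minus
            B.minus_eq_zero_iff)
    next
      case central
      then have "f x \<in> carrier B" using f by auto
      then show ?thesis
        using central sym by (auto simp: cl gen f_def[of Gamma_Half] f_def[of Gamma_Neg_Half]
            B.commutator_scalar_left)
    next
      case heis
      let ?e = "if k + m = 0 then qa a d k i j / (q - inverse q) else 0"
      have hcl: "free_gen (H i k) \<in> carrier ?F" "free_gen (H j m) \<in> carrier ?F"
        using heis sym cl by auto
      have fh: "free_lift B f (free_gen (H i k)) = h i k" "free_lift B f (free_gen (H j m)) = h j m"
        using heis sym by (simp_all add: gen f_def)
      have "commutator B (h i k) (h j m)
          = (?e * (q powi (k * l) - q powi (- k * l))) \<odot>\<^bsub>B\<^esub> \<one>\<^bsub>B\<^esub>"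
        using h heis unfolding heisenberg_family_def heisenberg_scalar by blast
      also have "\<dots> = ?e \<odot>\<^bsub>B\<^esub> ((q powi (k * l)) \<odot>\<^bsub>B\<^esub> \<one>\<^bsub>B\<^esub> \<ominus>\<^bsub>B\<^esub> (q powi (- k * l)) \<odot>\<^bsub>B\<^esub> \<one>\<^bsub>B\<^esub>)"
        by (simp only: B.smult_smult B.smult_diff[symmetric] B.one_closed)
      finally have rel: "commutator B (h i k) (h j m) = \<dots>" .
      have "free_lift B f r = commutator B (h i k) (h j m) \<ominus>\<^bsub>B\<^esub>
          ?e \<odot>\<^bsub>B\<^esub> ((q powi (k * l)) \<odot>\<^bsub>B\<^esub> \<one>\<^bsub>B\<^esub> \<ominus>\<^bsub>B\<^esub> (q powi (- k * l)) \<odot>\<^bsub>B\<^esub> \<one>\<^bsub>B\<^esub>)"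
        unfolding heis(1) using hcl heis_gamma_free_closed[of n]
        by (simp only: lift.hom_minus lift.hom_smult lift.hom_commutator gamma fh
            lift.source.commutator_closed lift.source.minus_closed lift.source.smult_closed)
      then show ?thesis
        unfolding rel by (simp only: B.minus_eq_zero_iff B.smult_closed B.minus_closed B.one_closed)
    qed
  qed
  then obtain \<phi> where \<phi>: "\<phi> \<in> algebra_hom ?G B"
      and \<phi>_proj: "\<And>u. u \<in> carrier ?F \<Longrightarrow> \<phi> (?\<pi> u) = free_lift B f u"
    using presented_algebra_universal[OF B heis_relations_closed f, of a d] by (auto simp: heis_def)
  interpret \<phi>: algebra_morphism ?G B \<phi>
    by (intro algebra_morphism.intro algebra_morphism_axioms.intro heis_algebra B \<phi>)
  let ?g = "heis_gen n a d Gamma_Half"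
  have g: "?g \<in> carrier ?G" by (rule heis_gen_closed[OF sym(1)])
  have \<phi>g: "\<phi> ?g = (q_half powi l) \<odot>\<^bsub>B\<^esub> \<one>\<^bsub>B\<^esub>"
    by (simp add: heis_gen_eq_proj \<phi>_proj cl gen sym f_def)
  let ?T = "{?g [^]\<^bsub>?G\<^esub> (2::nat) \<ominus>\<^bsub>?G\<^esub> (q powi l) \<odot>\<^bsub>?G\<^esub> \<one>\<^bsub>?G\<^esub>,
             ?g \<ominus>\<^bsub>?G\<^esub> (q_half powi l) \<odot>\<^bsub>?G\<^esub> \<one>\<^bsub>?G\<^esub>}"
  have T: "?T \<subseteq> carrier ?G" using g by simp
  have "(q_half powi l)\<^sup>2 = q powi l"
    using q_half_powi_power[of l 1] by simp
  then have "\<phi> t = \<zero>\<^bsub>B\<^esub>" if "t \<in> ?T" for t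
    using that g by (auto simp: \<phi>g B.scalar_power B.minus_eq_zero_iff)
  from \<phi>.hom_descends[OF T this]
  obtain \<psi> where \<psi>: "\<psi> \<in> algebra_hom (heis_level n a d l) B"
      "\<And>x. x \<in> carrier ?G \<Longrightarrow> \<psi> (level_class n a d l x) = \<phi> x"
    by (auto simp: heis_level_def heis_level_ideal_def level_class_def)
  have "\<psi> (level_proj n a d l (free_gen (H i k))) = h i k" if "i \<in> {1..n}" "k \<noteq> 0" for i k
  proof -
    have s: "H i k \<in> heis_symbols n" using that sym by blast
    have "\<psi> (level_proj n a d l (free_gen (H i k))) = \<phi> (?\<pi> (free_gen (H i k)))"
      using \<psi>(2)[OF heis_gen_closed[OF s, of a d]] by (simp add: level_proj_def heis_gen_eq_proj)
    also have "\<dots> = h i k"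
      using \<phi>_proj[OF cl[OF s]] gen[OF s] by (simp add: f_def)
    finally show ?thesis .
  qed
  then show ?thesis using \<psi>(1) by blast
qed

section \<open>The universal property of the Weyl algebra\<close>

lemma weyl_relations_closed: "weyl_relations n \<subseteq> carrier (weyl_free n)"
proof -
  interpret F: assoc_algebra "weyl_free n" by (rule assoc_algebra_free_algebra)
  have "free_gen (X i k) \<in> carrier (weyl_free n)" "free_gen (Partial i k) \<in> carrier (weyl_free n)"
    if "i \<in> {1..n}" "k > 0" for i k
    using that by (auto intro!: free_gen_closed simp: weyl_symbols_def)
  then show ?thesis
    by (auto simp: weyl_relations_def)
qed

lemma weyl_algebra:
  "assoc_algebra (weyl n)"
  "presented_proj (weyl_symbols n) (weyl_relations n) \<in> algebra_hom (weyl_free n) (weyl n)"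
  "carrier (weyl n) = presented_proj (weyl_symbols n) (weyl_relations n) ` carrier (weyl_free n)"
  "r \<in> weyl_relations n \<Longrightarrow> presented_proj (weyl_symbols n) (weyl_relations n) r = \<zero>\<^bsub>weyl n\<^esub>"
  using presented_algebra[OF weyl_relations_closed[of n]] by (simp_all add: weyl_def)

lemma weyl_gen_eq_proj:
  "weyl_gen n s = presented_proj (weyl_symbols n) (weyl_relations n) (free_gen s)"
  by (simp add: weyl_gen_def presented_gen_def presented_proj_def)

text \<open>
  The presentation has no relation for two equal generators \<open>X\<^sub>i\<^sub>k\<close> or \<open>\<partial>\<^sub>i\<^sub>k\<close>, which commute in any
  algebra.
\<close>
lemma weyl_gen_weyl_family:
  "weyl_family (weyl n) {1..n} (\<lambda>i k. weyl_gen n (X i k)) (\<lambda>i k. weyl_gen n (Partial i k))"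
proof -
  let ?\<pi> = "presented_proj (weyl_symbols n) (weyl_relations n)"
  interpret p: algebra_morphism "weyl_free n" "weyl n" ?\<pi>
    by (intro algebra_morphism.intro algebra_morphism_axioms.intro assoc_algebra_free_algebra
        weyl_algebra)
  have cl: "free_gen (X i k) \<in> carrier (weyl_free n)" "free_gen (Partial i k) \<in> carrier (weyl_free n)"
    if "i \<in> {1..n}" "k > 0" for i k
    using that by (auto intro!: free_gen_closed simp: weyl_symbols_def)
  have gcl: "weyl_gen n (X i k) \<in> carrier (weyl n)" "weyl_gen n (Partial i k) \<in> carrier (weyl n)"
    if "i \<in> {1..n}" "k > 0" for i k
    using cl[OF that] by (simp_all add: weyl_gen_eq_proj)
  have one: "commutator (weyl n) (weyl_gen n (Partial i k)) (weyl_gen n (X i k)) = \<one>\<^bsub>weyl n\<^esub>"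
    if "i \<in> {1..n}" "k > 0" for i k
  proof -
    have "?\<pi> (commutator (weyl_free n) (free_gen (Partial i k)) (free_gen (X i k))
        \<ominus>\<^bsub>weyl_free n\<^esub> \<one>\<^bsub>weyl_free n\<^esub>) = \<zero>\<^bsub>weyl n\<^esub>"
      by (rule weyl_algebra(4)) (use that in \<open>unfold weyl_relations_def, blast\<close>)
    then show ?thesis
      using cl[OF that] by (simp add: weyl_gen_eq_proj p.target.minus_eq_zero_iff)
  qed
  have zero: "commutator (weyl n) (weyl_gen n (s i k)) (weyl_gen n (t j m)) = \<zero>\<^bsub>weyl n\<^esub>"
    if st: "(s, t) \<in> {(X, X), (Partial, X), (Partial, Partial)}"
      and ij: "i \<in> {1..n}" "j \<in> {1..n}" "k > 0" "m > 0" "(i, k) \<noteq> (j, m)" for s t i j k m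
  proof -
    have "?\<pi> (commutator (weyl_free n) (free_gen (s i k)) (free_gen (t j m))) = \<zero>\<^bsub>weyl n\<^esub>"
      by (rule weyl_algebra(4)) (use st ij in \<open>unfold weyl_relations_def, blast\<close>)
    moreover have "free_gen (s i k) \<in> carrier (weyl_free n)" "free_gen (t j m) \<in> carrier (weyl_free n)"
      using st ij cl by auto
    ultimately show ?thesis by (simp add: weyl_gen_eq_proj)
  qed
  show ?thesis
    unfolding weyl_family_def
  proof (intro conjI ballI allI impI)
    fix i j k m assume ij: "i \<in> {1..n}" "j \<in> {1..n}" and km: "k > (0::int)" "m > (0::int)"
    show "commutator (weyl n) (weyl_gen n (X i k)) (weyl_gen n (X j m)) = \<zero>\<^bsub>weyl n\<^esub>"
      using zero[of X X i j k m] p.target.commutator_self[OF gcl(1)[OF ij(1) km(1)]] ij km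
      by (cases "(i, k) = (j, m)") auto
    show "commutator (weyl n) (weyl_gen n (Partial i k)) (weyl_gen n (Partial j m)) = \<zero>\<^bsub>weyl n\<^esub>"
      using zero[of Partial Partial i j k m] p.target.commutator_self[OF gcl(2)[OF ij(1) km(1)]] ij km
      by (cases "(i, k) = (j, m)") auto
    show "commutator (weyl n) (weyl_gen n (Partial i k)) (weyl_gen n (X j m))
        = (if (i, k) = (j, m) then 1 else 0) \<odot>\<^bsub>weyl n\<^esub> \<one>\<^bsub>weyl n\<^esub>"
      using zero[of Partial X i j k m] one[OF ij(1) km(1)] ij km
      by (cases "(i, k) = (j, m)") auto
  qed (use gcl in auto)
qed

lemma weyl_universal:
  assumes B: "assoc_algebra B" and W: "weyl_family B {1..n} x p"
  shows "\<exists>\<phi> \<in> algebra_hom (weyl n) B. \<forall>i\<in>{1..n}. \<forall>k>0.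
    \<phi> (weyl_gen n (X i k)) = x i k \<and> \<phi> (weyl_gen n (Partial i k)) = p i k"
proof -
  interpret B: assoc_algebra B by (rule B)
  let ?F = "weyl_free n"
  define f where "f s = (case s of X i k \<Rightarrow> x i k | Partial i k \<Rightarrow> p i k)" for s
  have f: "f \<in> weyl_symbols n \<rightarrow> carrier B"
    using W by (auto simp: f_def weyl_symbols_def weyl_family_def)
  interpret lift: algebra_morphism ?F B "free_lift B f"
    by (intro algebra_morphism.intro algebra_morphism_axioms.intro assoc_algebra_free_algebra B
        B.free_lift_hom[OF f])
  have sym: "X i k \<in> weyl_symbols n" "Partial i k \<in> weyl_symbols n" if "i \<in> {1..n}" "k > 0" for i k
    using that by (auto simp: weyl_symbols_def)
  have cl: "free_gen (X i k) \<in> carrier ?F" "free_gen (Partial i k) \<in> carrier ?F"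
    and gen: "free_lift B f (free_gen (X i k)) = x i k" "free_lift B f (free_gen (Partial i k)) = p i k"
    if "i \<in> {1..n}" "k > 0" for i k
    using sym[OF that] by (simp_all add: free_gen_closed B.free_lift_free_gen[OF f] f_def)
  have rel: "commutator B (x i k) (x j m) = \<zero>\<^bsub>B\<^esub>" "commutator B (p i k) (p j m) = \<zero>\<^bsub>B\<^esub>"
      "commutator B (p i k) (x j m) = (if (i, k) = (j, m) then 1 else 0) \<odot>\<^bsub>B\<^esub> \<one>\<^bsub>B\<^esub>"
    if "i \<in> {1..n}" "j \<in> {1..n}" "k > 0" "m > 0" for i j k m
    using W that unfolding weyl_family_def by blast+
  have "free_lift B f r = \<zero>\<^bsub>B\<^esub>" if r: "r \<in> weyl_relations n" for r
  proof -
    consider (one) i k where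
        "r = commutator ?F (free_gen (Partial i k)) (free_gen (X i k)) \<ominus>\<^bsub>?F\<^esub> \<one>\<^bsub>?F\<^esub>"
        "i \<in> {1..n}" "k > 0"
      | (zero) s t i j k m where "r = commutator ?F (free_gen (s i k)) (free_gen (t j m))"
        "(s, t) \<in> {(X, X), (Partial, X), (Partial, Partial)}"
        "i \<in> {1..n}" "j \<in> {1..n}" "k > 0" "m > 0" "(i, k) \<noteq> (j, m)"
      using r unfolding weyl_relations_def by blast
    then show ?thesis
    proof cases
      case one
      then show ?thesis
        using rel(3)[of i i k k] cl[OF one(2,3)] by (simp add: gen B.minus_eq_zero_iff)
    next
      case zero
      then show ?thesis
        using rel[OF zero(3-6)] cl[OF zero(3,5)] cl[OF zero(4,6)] gen[OF zero(3,5)] gen[OF zero(4,6)]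
        by auto
    qed
  qed
  then obtain \<phi> where "\<phi> \<in> algebra_hom (weyl n) B"
      "\<And>u. u \<in> carrier ?F \<Longrightarrow> \<phi> (presented_proj (weyl_symbols n) (weyl_relations n) u) = free_lift B f u"
    using presented_algebra_universal[OF B weyl_relations_closed f] by (auto simp: weyl_def)
  then show ?thesis
    using cl gen by (intro bexI[of _ \<phi>]) (simp_all add: weyl_gen_eq_proj)
qed

section \<open>The isomorphism\<close>

theorem proposition2p1:
  fixes n :: nat and a :: "nat \<Rightarrow> nat \<Rightarrow> int" and d :: "nat \<Rightarrow> nat" and l :: int
  assumes "untwisted_affine_cartan_matrix n a"
    and "\<forall>i\<in>{0..n}. d i > 0"
    and "Gcd (d ` {0..n}) = 1"
    and "\<forall>i\<in>{0..n}. \<forall>j\<in>{0..n}. int (d i) * a i j = int (d j) * a j i"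
    and "l \<noteq> 0"
  shows "\<exists>\<psi> \<in> algebra_iso (heis_level n a d l) (weyl n).
           \<forall>i\<in>{1..n}. \<forall>k>0.
             \<psi> (level_class n a d l (heis_h n a d i k))
               = qnum q (k * l) \<odot>\<^bsub>weyl n\<^esub> weyl_gen n (Partial i k) \<and>
             \<psi> (level_class n a d l (heis_h' n a d i k)) = weyl_gen n (X i k)"
proof -
  let ?L = "heis_level n a d l" and ?W = "weyl n" and ?I = "{1..n}"
  let ?\<pi> = "level_proj n a d l" and ?w = "\<lambda>k. qnum q (k * l)"
  let ?P = "\<lambda>i k. weyl_gen n (Partial i k)" and ?X = "\<lambda>i k. weyl_gen n (X i k)"
  \<comment> \<open>\<open>H'\<close> is the given family in the quotient and \<open>X'\<close> the class of the elements \<open>h'\<close>; \<open>hW\<close> will be the image of \<open>H'\<close>\<close>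
  define H' where "H' i k = ?\<pi> (free_gen (H i k))" for i k
  define X' where "X' j k = (\<Oplus>\<^bsub>?L\<^esub>m\<in>?I. qb n a d k m j \<odot>\<^bsub>?L\<^esub> H' m (- k))" for j k
  define hW where "hW i k = (if k > 0 then ?w k \<odot>\<^bsub>?W\<^esub> ?P i k
      else (\<Oplus>\<^bsub>?W\<^esub>m\<in>?I. qa a d (- k) m i \<odot>\<^bsub>?W\<^esub> ?X m (- k)))" for i k
  obtain D where D: "finite_type_symmetrizer ?I a D"
    using assms(1) unfolding untwisted_affine_cartan_matrix_def by blast
  have inv: "is_inverse_matrix ?I (qa a d k) (qb n a d k)" if "k > 0" for k
    by (rule qa_invertible[OF D]) (use assms(2) that in auto)
  have w: "?w k \<noteq> 0" if "k > 0" for k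
    using that assms(5) by (intro qnum_q_nonzero) auto
  interpret L: assoc_algebra ?L by (rule heis_level_algebra)
  interpret W: assoc_algebra ?W by (rule weyl_algebra)
  note hL = heis_level_heisenberg_family[of n a d l, folded H'_def]
  have xW: "weyl_family ?L ?I X' (\<lambda>i k. inverse (?w k) \<odot>\<^bsub>?L\<^esub> H' i k)"
    unfolding X'_def using hL w inv by (intro L.weyl_family_of_heisenberg_family) auto
  have hW: "heisenberg_family ?W ?I (qa a d) ?w hW"
    unfolding hW_def
  proof (rule W.heisenberg_family_of_weyl_family[OF weyl_gen_weyl_family])
    show "qnum q (- k * l) = - qnum q (k * l)" for k by (simp add: qnum_minus)
    show "qa a d (- k) i j = qa a d k j i" if "i \<in> ?I" "j \<in> ?I" for k i j
      using assms(4) that by (intro qa_minus_transpose) auto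
  qed simp
  obtain \<psi> where \<psi>: "\<psi> \<in> algebra_hom ?L ?W"
      and \<psi>H: "\<And>i k. i \<in> ?I \<Longrightarrow> k \<noteq> 0 \<Longrightarrow> \<psi> (H' i k) = hW i k"
    using heis_level_universal[OF W.assoc_algebra_axioms hW, folded H'_def] by blast
  obtain \<phi> where \<phi>: "\<phi> \<in> algebra_hom ?W ?L"
      and \<phi>X: "\<And>i k. i \<in> ?I \<Longrightarrow> k > 0 \<Longrightarrow> \<phi> (?X i k) = X' i k"
      and \<phi>P: "\<And>i k. i \<in> ?I \<Longrightarrow> k > 0 \<Longrightarrow> \<phi> (?P i k) = inverse (?w k) \<odot>\<^bsub>?L\<^esub> H' i k"
    using weyl_universal[OF L.assoc_algebra_axioms xW] by blast
  interpret \<psi>: algebra_morphism ?L ?W \<psi> by unfold_locales (rule \<psi>)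
  interpret \<phi>: algebra_morphism ?W ?L \<phi> by unfold_locales (rule \<phi>)
  have Hcl: "H' i k \<in> carrier ?L" if "i \<in> ?I" "k \<noteq> 0" for i k
    using hL that by (auto simp: heisenberg_family_def)
  have Wcl: "?X i k \<in> carrier ?W" "?P i k \<in> carrier ?W" if "i \<in> ?I" "k > 0" for i k
    using weyl_gen_weyl_family[of n] that by (auto simp: weyl_family_def)
  have \<psi>X: "\<psi> (X' j k) = ?X j k" if "j \<in> ?I" "k > 0" for j k
  proof -
    have "\<psi> (X' j k) = (\<Oplus>\<^bsub>?W\<^esub>m\<in>?I. \<psi> (qb n a d k m j \<odot>\<^bsub>?L\<^esub> H' m (- k)))"
      unfolding X'_def using that Hcl by (intro \<psi>.hom_finsum) auto
    also have "\<dots> = (\<Oplus>\<^bsub>?W\<^esub>m\<in>?I. qb n a d k m j \<odot>\<^bsub>?W\<^esub> (\<Oplus>\<^bsub>?W\<^esub>r\<in>?I. qa a d k r m \<odot>\<^bsub>?W\<^esub> ?X r k))"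
    proof (rule W.finsum_cong')
      show "(\<lambda>m. qb n a d k m j \<odot>\<^bsub>?W\<^esub> (\<Oplus>\<^bsub>?W\<^esub>r\<in>?I. qa a d k r m \<odot>\<^bsub>?W\<^esub> ?X r k)) \<in> ?I \<rightarrow> carrier ?W"
        using Wcl that by (intro Pi_I W.smult_closed W.lincomb_closed) auto
      show "\<psi> (qb n a d k m j \<odot>\<^bsub>?L\<^esub> H' m (- k))
          = qb n a d k m j \<odot>\<^bsub>?W\<^esub> (\<Oplus>\<^bsub>?W\<^esub>r\<in>?I. qa a d k r m \<odot>\<^bsub>?W\<^esub> ?X r k)" if "m \<in> ?I" for m
        using that \<open>k > 0\<close> Hcl[of m "- k"] by (simp add: \<psi>H hW_def)
    qed simp
    also have "\<dots> = ?X j k"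
    proof (rule W.lincomb_inverse_matrix)
      show "(\<Sum>m\<in>?I. qa a d k r m * qb n a d k m j) = (if r = j then 1 else 0)" if "r \<in> ?I" for r
        using inv[OF \<open>k > 0\<close>] that \<open>j \<in> ?I\<close> by (simp add: is_inverse_matrix_def)
    qed (use Wcl that in auto)
    finally show ?thesis .
  qed
  have \<phi>H_pos: "\<phi> (hW i k) = H' i k" if "i \<in> ?I" "k > 0" for i k
    using that Wcl(2)[OF that] Hcl[of i k] w[of k] by (simp add: hW_def \<phi>P L.smult_smult)
  have \<phi>H_neg: "\<phi> (hW i (- k)) = H' i (- k)" if "i \<in> ?I" "k > 0" for i k
  proof -
    have "\<phi> (hW i (- k)) = \<phi> (\<Oplus>\<^bsub>?W\<^esub>m\<in>?I. qa a d k m i \<odot>\<^bsub>?W\<^esub> ?X m k)"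
      using that by (simp add: hW_def)
    also have "\<dots> = (\<Oplus>\<^bsub>?L\<^esub>m\<in>?I. \<phi> (qa a d k m i \<odot>\<^bsub>?W\<^esub> ?X m k))"
      using Wcl that by (intro \<phi>.hom_finsum) auto
    also have "\<dots> = (\<Oplus>\<^bsub>?L\<^esub>m\<in>?I. qa a d k m i \<odot>\<^bsub>?L\<^esub> (\<Oplus>\<^bsub>?L\<^esub>r\<in>?I. qb n a d k r m \<odot>\<^bsub>?L\<^esub> H' r (- k)))"
    proof (rule L.finsum_cong')
      show "(\<lambda>m. qa a d k m i \<odot>\<^bsub>?L\<^esub> (\<Oplus>\<^bsub>?L\<^esub>r\<in>?I. qb n a d k r m \<odot>\<^bsub>?L\<^esub> H' r (- k))) \<in> ?I \<rightarrow> carrier ?L"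
        using Hcl that by (intro Pi_I L.smult_closed L.lincomb_closed) auto
      show "\<phi> (qa a d k m i \<odot>\<^bsub>?W\<^esub> ?X m k)
          = qa a d k m i \<odot>\<^bsub>?L\<^esub> (\<Oplus>\<^bsub>?L\<^esub>r\<in>?I. qb n a d k r m \<odot>\<^bsub>?L\<^esub> H' r (- k))" if "m \<in> ?I" for m
        using that \<open>k > 0\<close> Wcl[of m k] by (simp add: \<phi>X X'_def)
    qed simp
    also have "\<dots> = H' i (- k)"
    proof (rule L.lincomb_inverse_matrix)
      show "(\<Sum>m\<in>?I. qb n a d k r m * qa a d k m i) = (if r = i then 1 else 0)" if "r \<in> ?I" for r
        using inv[OF \<open>k > 0\<close>] that \<open>i \<in> ?I\<close> by (simp add: is_inverse_matrix_def)
    qed (use Hcl that in auto)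
    finally show ?thesis .
  qed
  have \<phi>\<psi>: "\<phi> (\<psi> x) = x" if "x \<in> carrier ?L" for x
  proof -
    have "(\<phi> \<circ> \<psi>) x = id x"
    proof (rule hom_eqI_on_generators[OF L.assoc_algebra_axioms heis_level_algebra(3,4)
          algebra_hom_comp[OF \<psi> \<phi>] algebra_hom_id _ that])
      fix s assume s: "s \<in> heis_symbols n"
      show "(\<phi> \<circ> \<psi>) (?\<pi> (free_gen s)) = id (?\<pi> (free_gen s))"
      proof (cases s)
        case (H i k)
        then have ik: "i \<in> ?I" "k \<noteq> 0" using s by (auto simp: heis_symbols_def)
        have "\<phi> (hW i k) = H' i k"
          using \<phi>H_pos[of i k] \<phi>H_neg[of i "- k"] ik by (cases "k > 0") auto
        then show ?thesis using H ik \<psi>H[of i k] by (simp add: H'_def)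
      qed (simp_all add: heis_level_algebra(5) level_proj_Gamma_Neg_Half)
    qed
    then show ?thesis by simp
  qed
  have \<psi>\<phi>: "\<psi> (\<phi> y) = y" if "y \<in> carrier ?W" for y
  proof -
    have "(\<psi> \<circ> \<phi>) y = id y"
    proof (rule hom_eqI_on_generators[OF W.assoc_algebra_axioms weyl_algebra(2,3)
          algebra_hom_comp[OF \<phi> \<psi>] algebra_hom_id _ that])
      fix s assume s: "s \<in> weyl_symbols n"
      have "(\<psi> \<circ> \<phi>) (weyl_gen n s) = id (weyl_gen n s)"
      proof (cases s)
        case (X i k)
        then have "i \<in> ?I" "k > 0" using s by (auto simp: weyl_symbols_def)
        then show ?thesis using X by (simp add: \<phi>X \<psi>X)
      next
        case (Partial i k)
        then have ik: "i \<in> ?I" "k > 0" using s by (auto simp: weyl_symbols_def)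
        then show ?thesis
          using Partial Hcl[of i k] Wcl(2)[OF ik] w[of k]
          by (simp add: \<phi>P \<psi>H hW_def W.smult_smult)
      qed
      then show "(\<psi> \<circ> \<phi>) (presented_proj (weyl_symbols n) (weyl_relations n) (free_gen s))
          = id (presented_proj (weyl_symbols n) (weyl_relations n) (free_gen s))"
        by (simp only: weyl_gen_eq_proj)
    qed
    then show ?thesis by simp
  qed
  have iso: "\<psi> \<in> algebra_iso ?L ?W"
    by (rule algebra_iso_of_inverse_homs[OF \<psi> \<phi> \<phi>\<psi> \<psi>\<phi>])
  interpret G: assoc_algebra "heis n a d" by (rule heis_algebra)
  interpret cls: algebra_morphism "heis n a d" ?L "level_class n a d l"
    by unfold_locales (rule heis_level_algebra)
  have h: "level_class n a d l (heis_h n a d i k) = H' i k" for i k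
    by (simp add: H'_def level_proj_def heis_gen_eq_proj)
  have h': "level_class n a d l (heis_h' n a d j k) = X' j k" if "k > 0" for j k
  proof -
    have gcl: "heis_h n a d m (- k) \<in> carrier (heis n a d)" if "m \<in> ?I" for m
      using that \<open>k > 0\<close> by (intro heis_gen_closed) (auto simp: heis_symbols_def)
    have "level_class n a d l (heis_h' n a d j k)
        = (\<Oplus>\<^bsub>?L\<^esub>m\<in>?I. level_class n a d l (qb n a d k m j \<odot>\<^bsub>heis n a d\<^esub> heis_h n a d m (- k)))"
      unfolding heis_h'_def using gcl by (intro cls.hom_finsum) auto
    also have "\<dots> = X' j k"
      unfolding X'_def
    proof (rule L.finsum_cong')
      show "level_class n a d l (qb n a d k m j \<odot>\<^bsub>heis n a d\<^esub> heis_h n a d m (- k))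
          = qb n a d k m j \<odot>\<^bsub>?L\<^esub> H' m (- k)" if "m \<in> ?I" for m
        using gcl[OF that] by (simp add: h)
    qed (use Hcl \<open>k > 0\<close> in auto)
    finally show ?thesis .
  qed
  have "\<psi> (level_class n a d l (heis_h n a d i k)) = ?w k \<odot>\<^bsub>?W\<^esub> ?P i k \<and>
        \<psi> (level_class n a d l (heis_h' n a d i k)) = ?X i k" if "i \<in> ?I" "k > 0" for i k
    using that by (simp add: h h' \<psi>H hW_def \<psi>X)
  then show ?thesis using iso by blast
qed

end
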